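(* Let $\tau > \omega$ be a cardinal and let $h \colon Z \to F$ be a homeomorphism between $Z_{\tau}$-sets in $I^{\tau}$. Then there is an autohomeomorphism $H$ of $I^{\tau}$ such that $H|Z = h$.
   Context: All spaces are Tychonoff and all maps are continuous. $I=[0,1]$ and $I^{\tau}$ is the product of $\tau$ copies of $I$ with the product topology (Tychonoff cube). Two subsets $P,Q$ of $X$ are functionally separated if there is a continuous $u\colon X\to[0,1]$ with $u|P\equiv 0$ and $u|Q\equiv 1$. For a space $Y$, $\operatorname{cov}(Y)$ is the collection of all countable functionally open covers of $Y$ (countable covers by cozero-sets). Maps $f,g\colon X\to Y$ are $\mathcal U$-close ($\mathcal U\in\operatorname{cov}(Y)$) if for each $x\in X$ there is $U\in\mathcal U$ containing both $f(x)$ and $g(x)$. For a family $\{\mathcal U_t\colon t\in T\}\subseteq\operatorname{cov}(Y)$ put $B(f,\{\mathcal U_t\colon t\in T\})=\{g\in C(X,Y)\colon g \text{ is } \mathcal U_t\text{-close to } f \text{ for each } t\in T\}$. For an infinite cardinal $\tau$, $C_\tau(X,Y)$ is the set of all continuous maps $X\to Y$ with the following topology: $G$ is open iff for each $h\in G$ there is a family $\{\mathcal U_t\colon t\in T\}\subseteq\operatorname{cov}(Y)$ with $|T|<\tau$ such that $B(h,\{\mathcal U_t\colon t\in T\})\subseteq G$. A closed subset $Z\subseteq X$ is a $Z_\tau$-set in $X$ if the set $\{f\in C_\tau(X,X)\colon f(X)\text{ and } Z \text{ are functionally separated}\}$ is dense in $C_\tau(X,X)$. *)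

theory Defs
  imports "HOL-Analysis.Analysis"
begin

unbundle cardinal_syntax

text \<open>
  A cardinal is a cardinal well-order \<open>\<tau> :: 'i rel\<close> (\<^const>\<open>card_order_on\<close> on its field); the cube
  of weight \<open>\<tau>\<close> has the elements of \<open>Field \<tau>\<close> as coordinates.
\<close>

definition tychonoff_cube :: "'i rel \<Rightarrow> ('i \<Rightarrow> real) topology" where
  "tychonoff_cube \<tau> = product_topology (\<lambda>i. top_of_set {0..1}) (Field \<tau>)"

definition functionally_separated :: "'a topology \<Rightarrow> 'a set \<Rightarrow> 'a set \<Rightarrow> bool" where
  "functionally_separated X P Q \<longleftrightarrow>
     (\<exists>u. continuous_map X (top_of_set {0..1::real}) u \<and> (\<forall>x\<in>P. u x = 0) \<and> (\<forall>x\<in>Q. u x = 1))"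

definition functionally_open :: "'a topology \<Rightarrow> 'a set \<Rightarrow> bool" where
  "functionally_open X U \<longleftrightarrow>
     (\<exists>u. continuous_map X euclideanreal u \<and> U = {x \<in> topspace X. u x \<noteq> 0})"

definition cov :: "'a topology \<Rightarrow> 'a set set set" where
  "cov Y = {\<U>. countable \<U> \<and> (\<forall>U\<in>\<U>. functionally_open Y U) \<and> \<Union>\<U> = topspace Y}"

definition cover_close :: "'a topology \<Rightarrow> 'b set set \<Rightarrow> ('a \<Rightarrow> 'b) \<Rightarrow> ('a \<Rightarrow> 'b) \<Rightarrow> bool" where
  "cover_close X \<U> f g \<longleftrightarrow> (\<forall>x\<in>topspace X. \<exists>U\<in>\<U>. f x \<in> U \<and> g x \<in> U)"

text \<open>
  Maps are taken extensional, so that two elements of the function space are equal as soon as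
  they agree on \<open>topspace X\<close>.
\<close>

definition continuous_maps :: "'a topology \<Rightarrow> 'b topology \<Rightarrow> ('a \<Rightarrow> 'b) set" where
  "continuous_maps X Y = {f \<in> extensional (topspace X). continuous_map X Y f}"

text \<open>
  Families of covers are given as sets of covers: \<open>B(f, {\<U>\<^sub>t : t \<in> T})\<close> depends only on the
  range of the family, whose cardinality is at most that of \<open>T\<close>.
\<close>

definition map_ball ::
    "'a topology \<Rightarrow> 'b topology \<Rightarrow> ('a \<Rightarrow> 'b) \<Rightarrow> 'b set set set \<Rightarrow> ('a \<Rightarrow> 'b) set" where
  "map_ball X Y f \<T> = {g \<in> continuous_maps X Y. \<forall>\<U>\<in>\<T>. cover_close X \<U> f g}"

definition open_maps ::
    "'i rel \<Rightarrow> 'a topology \<Rightarrow> 'b topology \<Rightarrow> ('a \<Rightarrow> 'b) set \<Rightarrow> bool" where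
  "open_maps \<tau> X Y G \<longleftrightarrow>
     G \<subseteq> continuous_maps X Y \<and>
     (\<forall>h\<in>G. \<exists>\<T>. \<T> \<subseteq> cov Y \<and> |\<T>| <o \<tau> \<and> map_ball X Y h \<T> \<subseteq> G)"

text \<open>
  The space \<open>C\<^sub>\<tau>(X,Y)\<close>. It is only meaningful for infinite \<open>\<tau>\<close>, where \<^const>\<open>open_maps\<close>
  is a topology; see \<open>openin_map_space\<close> below.
\<close>

definition map_space :: "'i rel \<Rightarrow> 'a topology \<Rightarrow> 'b topology \<Rightarrow> ('a \<Rightarrow> 'b) topology" where
  "map_space \<tau> X Y = topology (open_maps \<tau> X Y)"

definition Z_set :: "'i rel \<Rightarrow> 'a topology \<Rightarrow> 'a set \<Rightarrow> bool" where
  "Z_set \<tau> X Z \<longleftrightarrow>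
     closedin X Z \<and>
     map_space \<tau> X X closure_of
       {f \<in> continuous_maps X X. functionally_separated X (f ` topspace X) Z}
     = topspace (map_space \<tau> X X)"

lemma istopology_open_maps:
  assumes "Card_order \<tau>" "infinite (Field \<tau>)"
  shows "istopology (open_maps \<tau> X Y)"
  unfolding istopology_def
proof (intro conjI allI impI)
  fix S T assume S: "open_maps \<tau> X Y S" and T: "open_maps \<tau> X Y T"
  show "open_maps \<tau> X Y (S \<inter> T)"
    unfolding open_maps_def
  proof (intro conjI ballI)
    show "S \<inter> T \<subseteq> continuous_maps X Y" using S by (auto simp: open_maps_def)
    fix h assume h: "h \<in> S \<inter> T"
    obtain \<A> where A: "\<A> \<subseteq> cov Y" "|\<A>| <o \<tau>" "map_ball X Y h \<A> \<subseteq> S"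
      using S h by (auto simp: open_maps_def)
    obtain \<B> where B: "\<B> \<subseteq> cov Y" "|\<B>| <o \<tau>" "map_ball X Y h \<B> \<subseteq> T"
      using T h by (auto simp: open_maps_def)
    have "|\<A> \<union> \<B>| <o \<tau>"
      using card_of_Un_ordLess_infinite_Field assms A(2) B(2) by blast
    moreover have "map_ball X Y h (\<A> \<union> \<B>) \<subseteq> S \<inter> T"
      using A(3) B(3) by (auto simp: map_ball_def)
    ultimately show "\<exists>\<T>. \<T> \<subseteq> cov Y \<and> |\<T>| <o \<tau> \<and> map_ball X Y h \<T> \<subseteq> S \<inter> T"
      using A(1) B(1) by (intro exI[of _ "\<A> \<union> \<B>"]) auto
  qed
next
  fix \<K> assume "\<forall>K\<in>\<K>. open_maps \<tau> X Y K"
  then show "open_maps \<tau> X Y (\<Union>\<K>)"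
    unfolding open_maps_def by (meson Sup_least UnionE Union_upper subset_trans)
qed

lemma openin_map_space:
  assumes "Card_order \<tau>" "infinite (Field \<tau>)"
  shows "openin (map_space \<tau> X Y) = open_maps \<tau> X Y"
  unfolding map_space_def by (rule topology_inverse'[OF istopology_open_maps[OF assms]])

lemma topspace_map_space:
  fixes X :: "'a topology" and Y :: "'b topology"
  assumes "Card_order \<tau>" "infinite (Field \<tau>)"
  shows "topspace (map_space \<tau> X Y) = continuous_maps X Y"
proof -
  have "|{} :: 'b set set set| <o |Field \<tau>|"
    using assms(2) by (intro iffD1[OF card_of_ordLess2]) auto
  then have "|{} :: 'b set set set| <o \<tau>"
    using card_of_Field_ordIso[OF assms(1)] ordLess_ordIso_trans by blast
  then have "open_maps \<tau> X Y (continuous_maps X Y)"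
    unfolding open_maps_def by (auto simp: map_ball_def intro!: exI[of _ "{}"])
  then show ?thesis
    unfolding topspace_def openin_map_space[OF assms] by (auto simp: open_maps_def)
qed

end

theory Submission
  imports Defs
begin

text \<open>
  The homeomorphism is extended by Klee's trick.  Suppose that the index set is the disjoint union of
  \<open>X\<close> and \<open>Y\<close>, that \<open>Z\<close> lies in the open \<open>X\<close>-factor of the cube \<open>[-1, 1]\<^sup>\<tau>\<close> and \<open>F\<close> in the open
  \<open>Y\<close>-factor.  By Tietze's theorem \<open>h\<close> extends to a map of the \<open>X\<close>-factor to the open \<open>Y\<close>-factor, and
  sliding the \<open>Y\<close>-coordinates along this map moves \<open>Z\<close> to the graph of \<open>h\<close>.  Sliding the
  \<open>X\<close>-coordinates in the same manner, with the inverse of \<open>h\<close>, moves the graph to \<open>F\<close>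
  (\<open>graph_trick\<close>).  It remains to bring an arbitrary Z-set \<open>Z\<close> into such a position by an
  autohomeomorphism of the cube.  This takes three steps.

  The first step uses the hypothesis.  A set \<open>A\<close> of fewer than \<open>\<tau>\<close> coordinates gives rise to an open
  set of self-maps of the cube, those which preserve the coordinates in \<open>A\<close>.  It contains the
  identity, hence also a map whose image misses \<open>Z\<close>, so that there is a section over the coordinates
  in \<open>A\<close> that misses \<open>Z\<close>.  By compactness only finitely many further coordinates matter.  In these one
  can move \<open>Z\<close> off a face \<open>x j = 1\<close>, by a homeomorphism that depends continuously on the coordinates in
  \<open>A\<close> (\<open>block_off_face\<close>).  A transfinite recursion of length \<open>\<tau>\<close> produces \<open>\<tau>\<close> such blocks of
  coordinates, and the product of all these homeomorphisms is again a homeomorphism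
  (\<open>transfinite_block_product\<close>).  So \<open>Z\<close> may be assumed to miss \<open>\<tau>\<close> faces of this kind.

  In the second step all coordinates of the points of \<open>Z\<close> are moved into the open interval.  This is
  the difficulty of the homogeneity of the Hilbert cube: a coordinate equal to \<open>1\<close> cannot be moved
  inside by a homeomorphism acting on finitely many coordinates only.  Each coordinate is combined
  with a sequence of coordinates from the first step, and a homeomorphism of the square is applied
  along the sequence.  The square homeomorphism is chosen such that its inverse is a contraction in
  the direction in which values are carried along, and this makes the infinite composition a
  homeomorphism (\<open>autohomeo_rolling\<close>, \<open>rolling_into_interior\<close>).

  In the third step the coordinates in \<open>Y\<close> are encoded in those in \<open>X\<close>.  After a shear with growing
  factors each of them is a limit of expressions in a sequence of coordinates in \<open>X\<close>
  (\<open>projection_injective_after_shear\<close>).  Hence \<open>Z\<close> is part of a graph over the \<open>X\<close>-factor, and sliding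
  this graph to height zero completes the step (\<open>flatten_graph\<close>).
\<close>

section \<open>Cubes as compact sets of functions\<close>

text \<open>
  The Tychonoff cube is modelled on \<open>[-1, 1]\<close>, whose centre serves as a base point, and its points
  vanish outside the index set \<open>N\<close>.  In this way every such cube is a compact set of total functions
  with the topology of pointwise convergence, and continuity is checked one coordinate at a time.
\<close>

definition cube :: "'i set \<Rightarrow> ('i \<Rightarrow> real) set" where
  "cube N = {x. (\<forall>i\<in>N. \<bar>x i\<bar> \<le> 1) \<and> (\<forall>i. i \<notin> N \<longrightarrow> x i = 0)}"

lemma cube_abs_le: "x \<in> cube N \<Longrightarrow> \<bar>x i\<bar> \<le> 1"
  by (cases "i \<in> N") (auto simp: cube_def)

lemma cube_off: "x \<in> cube N \<Longrightarrow> i \<notin> N \<Longrightarrow> x i = 0"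
  by (auto simp: cube_def)

lemma cubeI: "(\<And>i. i \<in> N \<Longrightarrow> \<bar>x i\<bar> \<le> 1) \<Longrightarrow> (\<And>i. i \<notin> N \<Longrightarrow> x i = 0) \<Longrightarrow> x \<in> cube N"
  by (auto simp: cube_def)

lemma cube_override:
  assumes "x \<in> cube N" "y \<in> cube N"
  shows "(\<lambda>i. if i \<in> A then x i else y i) \<in> cube N"
  using assms by (auto simp: cube_def)

lemma compact_cube: "compact (cube N)"
proof -
  have "cube N = PiE UNIV (\<lambda>i. if i \<in> N then {-1..1} else {0})"
  proof (rule set_eqI)
    fix x :: "'a \<Rightarrow> real"
    show "x \<in> cube N \<longleftrightarrow> x \<in> PiE UNIV (\<lambda>i. if i \<in> N then {-1..1} else {0})"
      by (auto simp: cube_def PiE_UNIV_domain Pi_iff abs_le_iff split: if_splits)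
  qed
  moreover have "compactin (product_topology (\<lambda>i. euclideanreal) UNIV)
      (PiE UNIV (\<lambda>i. if i \<in> N then {-1..1} else {0}))"
    by (subst compactin_PiE) auto
  ultimately show ?thesis
    by (simp add: euclidean_product_topology)
qed

lemma Hausdorff_function_subspace: "Hausdorff_space (top_of_set (S :: ('i \<Rightarrow> real) set))"
proof -
  have "Hausdorff_space (product_topology (\<lambda>i::'i. euclideanreal) UNIV)"
    by (subst Hausdorff_space_product_topology) auto
  then show ?thesis
    by (simp add: euclidean_product_topology Hausdorff_space_subtopology)
qed

lemma closedin_cube_compact:
  assumes "compact Z" "Z \<subseteq> cube N"
  shows "closedin (top_of_set (cube N)) Z"
  by (rule compactin_imp_closedin[OF Hausdorff_function_subspace])
    (use assms in \<open>simp add: compactin_subtopology\<close>)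

lemma normal_space_cube: "normal_space (top_of_set (cube N))"
  by (rule compact_Hausdorff_or_regular_imp_normal_space)
    (simp_all add: Hausdorff_function_subspace compact_space_subtopology compact_cube)

lemma continuous_on_coordinate:
  "continuous_on S f \<Longrightarrow> continuous_on S (\<lambda>x. f x (i::'i) :: real)"
  by (rule continuous_on_product_then_coordinatewise)

lemma continuous_on_projection: "continuous_on S (\<lambda>x. x (i::'i) :: real)"
  by (rule continuous_on_coordinate[OF continuous_on_id])

definition autohomeo :: "'i set \<Rightarrow> (('i \<Rightarrow> real) \<Rightarrow> ('i \<Rightarrow> real)) \<Rightarrow> bool" where
  "autohomeo N f \<longleftrightarrow> continuous_on (cube N) f \<and> bij_betw f (cube N) (cube N)"

lemma continuous_on_compact_inverse:
  fixes f :: "('i \<Rightarrow> real) \<Rightarrow> ('j \<Rightarrow> real)"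
  assumes "compact S" "continuous_on S f" "inj_on f S"
  shows "continuous_on (f ` S) (inv_into S f)"
proof -
  have hm: "homeomorphic_map (top_of_set S) (top_of_set (f ` S)) f"
    by (rule continuous_imp_homeomorphic_map)
      (use assms in \<open>auto simp: Hausdorff_function_subspace compact_space_subtopology\<close>)
  then obtain g where g: "homeomorphic_maps (top_of_set S) (top_of_set (f ` S)) f g"
    using homeomorphic_map_maps by blast
  then have "continuous_on (f ` S) g" "\<forall>x\<in>S. g (f x) = x"
    by (auto simp: homeomorphic_maps_def)
  moreover have "inv_into S f y = g y" if "y \<in> f ` S" for y
    using that calculation(2) assms(3) by auto
  ultimately show ?thesis
    using continuous_on_cong by (metis (no_types, lifting))
qed

lemma autohomeo_mem: "autohomeo N f \<Longrightarrow> x \<in> cube N \<Longrightarrow> f x \<in> cube N"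
  by (auto simp: autohomeo_def bij_betw_def)

lemma autohomeo_inj: "autohomeo N f \<Longrightarrow> x \<in> cube N \<Longrightarrow> y \<in> cube N \<Longrightarrow> f x = f y \<Longrightarrow> x = y"
  by (auto simp: autohomeo_def bij_betw_def inj_on_def)

lemma autohomeo_id: "autohomeo N (\<lambda>x. x)"
  by (auto simp: autohomeo_def bij_betw_def)

lemma autohomeo_comp:
  assumes "autohomeo N f" "autohomeo N g"
  shows "autohomeo N (\<lambda>x. g (f x))"
proof -
  have "bij_betw (g \<circ> f) (cube N) (cube N)"
    using assms bij_betw_trans autohomeo_def by blast
  moreover have "continuous_on (cube N) (\<lambda>x. g (f x))"
    using assms continuous_on_compose2[of "cube N" g "cube N" f]
    by (auto simp: autohomeo_def bij_betw_def)
  ultimately show ?thesis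
    by (simp add: autohomeo_def o_def)
qed

lemma autohomeo_inverse:
  assumes "autohomeo N f"
  obtains g where "autohomeo N g" "\<And>x. x \<in> cube N \<Longrightarrow> g (f x) = x"
    "\<And>x. x \<in> cube N \<Longrightarrow> f (g x) = x"
proof
  have f: "continuous_on (cube N) f" "inj_on f (cube N)" "f ` cube N = cube N"
    using assms by (auto simp: autohomeo_def bij_betw_def)
  show "autohomeo N (inv_into (cube N) f)"
    unfolding autohomeo_def
    using continuous_on_compact_inverse[OF compact_cube f(1,2)] f
    by (simp add: bij_betw_inv_into bij_betw_def)
      (metis bij_betw_def bij_betw_inv_into)
  show "inv_into (cube N) f (f x) = x" if "x \<in> cube N" for x
    using f(2) that by (rule inv_into_f_f)
  show "f (inv_into (cube N) f x) = x" if "x \<in> cube N" for x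
    using that f(3) by (metis f_inv_into_f)
qed

lemma autohomeo_if_inverse:
  assumes "continuous_on (cube N) f" "\<And>x. x \<in> cube N \<Longrightarrow> f x \<in> cube N"
    "\<And>x. x \<in> cube N \<Longrightarrow> g x \<in> cube N"
    "\<And>x. x \<in> cube N \<Longrightarrow> g (f x) = x" "\<And>x. x \<in> cube N \<Longrightarrow> f (g x) = x"
  shows "autohomeo N f"
proof -
  have "bij_betw f (cube N) (cube N)"
  proof (rule bij_betw_byWitness[where f' = g])
    show "\<forall>a\<in>cube N. g (f a) = a" "\<forall>a\<in>cube N. f (g a) = a"
      using assms(4,5) by simp_all
    show "f ` cube N \<subseteq> cube N" "g ` cube N \<subseteq> cube N"
      using assms(2,3) by (simp_all add: image_subset_iff)
  qed
  then show ?thesis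
    using assms(1) by (simp add: autohomeo_def)
qed

text \<open>
  Tietze's theorem in the normal space \<open>cube N\<close>.  Values in the open interval are preserved, so
  that the extension can be used as the amount of a shift.
\<close>

lemma extend_function_from_compact:
  assumes "compact K" "K \<subseteq> cube N" "continuous_on K f" "\<And>x. x \<in> K \<Longrightarrow> \<bar>f x\<bar> < (1::real)"
  obtains g where "continuous_on (cube N) g" "\<And>x. x \<in> K \<Longrightarrow> g x = f x"
    "\<And>x. x \<in> cube N \<Longrightarrow> \<bar>g x\<bar> < 1"
proof -
  have i: "is_interval {-1<..<1::real}" "{-1<..<1::real} \<noteq> {}"
    by (simp_all add: is_interval_oo)
  have c: "continuous_map (subtopology (top_of_set (cube N)) K) euclideanreal f"
    using assms by (simp add: subtopology_subtopology Int_absorb1)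
  have im: "f ` K \<subseteq> {-1<..<1}"
    using assms(4) by (force simp: abs_less_iff)
  obtain g where "continuous_map (top_of_set (cube N)) euclideanreal g"
      "g ` topspace (top_of_set (cube N)) \<subseteq> {-1<..<1}" "\<And>x. x \<in> K \<Longrightarrow> g x = f x"
    using Tietze_extension_realinterval[OF normal_space_cube closedin_cube_compact[OF assms(1,2)] i c im]
    by blast
  then show thesis
    by (intro that[of g]) (auto simp: image_subset_iff abs_less_iff minus_less_iff)
qed

section \<open>Shifting coordinates\<close>

text \<open>
  This is the relativistic addition of velocities, that is, addition of real numbers transported to
  the open interval by the hyperbolic tangent.  For fixed \<open>u\<close> in the open interval it is a
  homeomorphism of the closed interval that fixes the end points and moves \<open>0\<close> to \<open>u\<close>.
\<close>

definition vadd :: "real \<Rightarrow> real \<Rightarrow> real" where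
  "vadd x u = (x + u) / (1 + x * u)"

lemma vadd_denom_pos:
  fixes x u :: real
  assumes "\<bar>x\<bar> \<le> 1" "\<bar>u\<bar> < 1"
  shows "0 < 1 + x * u"
proof -
  have "\<bar>x * u\<bar> \<le> 1 * \<bar>u\<bar>"
    using mult_right_mono[OF assms(1), of "\<bar>u\<bar>"] by (simp add: abs_mult)
  then show ?thesis using assms by linarith
qed

lemma vadd_abs_le:
  assumes "\<bar>x\<bar> \<le> 1" "\<bar>u\<bar> < 1"
  shows "\<bar>vadd x u\<bar> \<le> 1"
proof -
  have "(1 - x) * (1 - u) \<ge> 0" "(1 + x) * (1 + u) \<ge> 0"
    using assms by (auto intro!: mult_nonneg_nonneg)
  then show ?thesis
    using vadd_denom_pos[OF assms] by (simp add: vadd_def abs_le_iff field_simps)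
qed

lemma vadd_abs_less:
  assumes "\<bar>x\<bar> < 1" "\<bar>u\<bar> < 1"
  shows "\<bar>vadd x u\<bar> < 1"
proof -
  have "(1 - x) * (1 - u) > 0" "(1 + x) * (1 + u) > 0"
    using assms by (auto intro!: mult_pos_pos)
  then show ?thesis
    using vadd_denom_pos[of x u] assms by (simp add: vadd_def abs_less_iff field_simps)
qed

lemma vadd_minus_cancel:
  assumes "\<bar>x\<bar> \<le> 1" "\<bar>u\<bar> < 1"
  shows "vadd (vadd x u) (- u) = x"
proof -
  have p: "0 < 1 + x * u" by (rule vadd_denom_pos[OF assms])
  have u: "0 < 1 - u * u"
    using assms(2) by (metis abs_square_less_1 diff_gt_0_iff_gt power2_eq_square)
  have "vadd x u + - u = x * (1 - u * u) / (1 + x * u)"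
    using p by (simp add: vadd_def field_simps)
  moreover have "1 + vadd x u * - u = (1 - u * u) / (1 + x * u)"
    using p by (simp add: vadd_def field_simps)
  ultimately show ?thesis
    unfolding vadd_def[of "vadd x u"] using p u by simp
qed

lemma vadd_zero [simp]: "vadd 0 u = u"
  by (simp add: vadd_def)

lemma vadd_self [simp]: "vadd u (- u) = 0"
  by (simp add: vadd_def)

lemma continuous_on_vadd:
  assumes "continuous_on S f" "continuous_on S g"
    "\<And>x. x \<in> S \<Longrightarrow> \<bar>f x\<bar> \<le> 1" "\<And>x. x \<in> S \<Longrightarrow> \<bar>g x\<bar> < 1"
  shows "continuous_on S (\<lambda>x. vadd (f x) (g x))"
  unfolding vadd_def
proof (intro continuous_intros assms(1,2) ballI)
  fix x assume "x \<in> S"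
  then show "1 + f x * g x \<noteq> 0"
    using vadd_denom_pos[of "f x" "g x"] assms(3,4) by force
qed

definition shift :: "'i set \<Rightarrow> ('i \<Rightarrow> ('i \<Rightarrow> real) \<Rightarrow> real) \<Rightarrow> ('i \<Rightarrow> real) \<Rightarrow> ('i \<Rightarrow> real)" where
  "shift W c x = (\<lambda>i. if i \<in> W then vadd (x i) (c i x) else x i)"

text \<open>
  The amounts by which the coordinates in \<open>W\<close> are shifted may depend on the remaining coordinates
  only.  Those are not changed by the shift, and hence the shift by the opposite amounts undoes it.
\<close>

definition shift_data :: "'i set \<Rightarrow> 'i set \<Rightarrow> ('i \<Rightarrow> ('i \<Rightarrow> real) \<Rightarrow> real) \<Rightarrow> bool" where
  "shift_data N W c \<longleftrightarrow> W \<subseteq> N \<and> (\<forall>i\<in>W. continuous_on (cube N) (c i) \<and>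
     (\<forall>x\<in>cube N. \<bar>c i x\<bar> < 1) \<and>
     (\<forall>x\<in>cube N. \<forall>y\<in>cube N. (\<forall>k. k \<notin> W \<longrightarrow> x k = y k) \<longrightarrow> c i x = c i y))"

lemma shift_dataD:
  assumes "shift_data N W c" "i \<in> W"
  shows "W \<subseteq> N" and "continuous_on (cube N) (c i)"
    and "\<And>x. x \<in> cube N \<Longrightarrow> \<bar>c i x\<bar> < 1"
    and "\<And>x y. x \<in> cube N \<Longrightarrow> y \<in> cube N \<Longrightarrow> (\<And>k. k \<notin> W \<Longrightarrow> x k = y k) \<Longrightarrow> c i x = c i y"
proof -
  note * = assms(1)[unfolded shift_data_def]
  note ** = bspec[OF conjunct2[OF *] assms(2)]
  show "W \<subseteq> N" by (rule conjunct1[OF *])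
  show "continuous_on (cube N) (c i)" by (rule conjunct1[OF **])
  show "\<bar>c i x\<bar> < 1" if "x \<in> cube N" for x
    by (rule bspec[OF conjunct1[OF conjunct2[OF **]] that])
  show "c i x = c i y" if "x \<in> cube N" "y \<in> cube N" "\<And>k. k \<notin> W \<Longrightarrow> x k = y k" for x y
    by (rule mp[OF bspec[OF bspec[OF conjunct2[OF conjunct2[OF **]] that(1)] that(2)]])
      (simp add: that(3))
qed

lemma shift_mem:
  assumes "shift_data N W c" "x \<in> cube N"
  shows "shift W c x \<in> cube N"
proof (rule cubeI)
  fix i
  show "\<bar>shift W c x i\<bar> \<le> 1"
    using vadd_abs_le[OF cube_abs_le[OF assms(2)] shift_dataD(3)[OF assms(1) _ assms(2)]]
      cube_abs_le[OF assms(2)] by (simp add: shift_def)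
next
  fix i assume "i \<notin> N"
  then show "shift W c x i = 0"
    using shift_dataD(1)[OF assms(1)] cube_off[OF assms(2)] by (auto simp: shift_def)
qed

lemma shift_shift_back:
  assumes "shift_data N W c" "x \<in> cube N"
  shows "shift W (\<lambda>i x. - c i x) (shift W c x) = x"
proof
  fix i
  have "c i (shift W c x) = c i x" if "i \<in> W"
    by (rule shift_dataD(4)[OF assms(1) that shift_mem[OF assms] assms(2)]) (simp add: shift_def)
  moreover have "vadd (vadd (x i) (c i x)) (- c i x) = x i" if "i \<in> W"
    by (rule vadd_minus_cancel[OF cube_abs_le[OF assms(2)] shift_dataD(3)[OF assms(1) that assms(2)]])
  ultimately show "shift W (\<lambda>i x. - c i x) (shift W c x) i = x i"
    by (cases "i \<in> W") (simp_all add: shift_def)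
qed

lemma shift_data_uminus:
  assumes "shift_data N W c"
  shows "shift_data N W (\<lambda>i x. - c i x)"
  unfolding shift_data_def
proof (intro conjI ballI impI)
  show "W \<subseteq> N" using assms unfolding shift_data_def by blast
  fix i assume i: "i \<in> W"
  show "continuous_on (cube N) (\<lambda>x. - c i x)"
    by (rule continuous_on_minus[OF shift_dataD(2)[OF assms i]])
  show "\<bar>- c i x\<bar> < 1" if "x \<in> cube N" for x
    using shift_dataD(3)[OF assms i that] by simp
  show "- c i x = - c i y"
    if "x \<in> cube N" "y \<in> cube N" "\<forall>k. k \<notin> W \<longrightarrow> x k = y k" for x y
    using shift_dataD(4)[OF assms i that(1,2)] that(3) by simp
qed

lemma autohomeo_shift:
  assumes "shift_data N W c"
  shows "autohomeo N (shift W c)"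
proof (rule autohomeo_if_inverse[where g = "shift W (\<lambda>i x. - c i x)"])
  note m = shift_data_uminus[OF assms]
  show "continuous_on (cube N) (shift W c)"
  proof (rule continuous_on_coordinatewise_then_product)
    fix i
    show "continuous_on (cube N) (\<lambda>x. shift W c x i)"
    proof (cases "i \<in> W")
      case True
      have "continuous_on (cube N) (\<lambda>x. vadd (x i) (c i x))"
        by (rule continuous_on_vadd[OF continuous_on_projection
              shift_dataD(2)[OF assms True] _ shift_dataD(3)[OF assms True]])
          (simp_all add: cube_abs_le)
      then show ?thesis using True by (simp add: shift_def)
    qed (simp add: shift_def continuous_on_projection)
  qed
  show "shift W c x \<in> cube N" "shift W (\<lambda>i x. - c i x) x \<in> cube N" if "x \<in> cube N" for x
    using that shift_mem assms m by auto
  show "shift W (\<lambda>i x. - c i x) (shift W c x) = x" if "x \<in> cube N" for x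
    using that shift_shift_back[OF assms] by auto
  show "shift W c (shift W (\<lambda>i x. - c i x) x) = x" if "x \<in> cube N" for x
    using that shift_shift_back[OF m] by auto
qed

section \<open>Shrinking opposite sides of the square\<close>

definition square :: "(real \<times> real) set" where
  "square = {-1..1} \<times> {-1..1}"

definition square_homeo :: "(real \<times> real \<Rightarrow> real \<times> real) \<Rightarrow> bool" where
  "square_homeo f \<longleftrightarrow> continuous_on square f \<and> bij_betw f square square"

lemma square_homeo_comp:
  assumes "square_homeo f" "square_homeo g"
  shows "square_homeo (g \<circ> f)"
proof -
  have "continuous_on square (g \<circ> f)"
    using assms unfolding square_homeo_def
    by (intro continuous_on_compose) (auto simp: bij_betw_def)
  moreover have "bij_betw (g \<circ> f) square square"
    using assms bij_betw_trans unfolding square_homeo_def by blast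
  ultimately show ?thesis by (simp add: square_homeo_def)
qed

lemma square_homeo_inverse:
  assumes "square_homeo f"
  obtains g where "square_homeo g" "\<And>p. p \<in> square \<Longrightarrow> g (f p) = p"
    "\<And>p. p \<in> square \<Longrightarrow> f (g p) = p"
proof
  have f: "continuous_on square f" "inj_on f square" "f ` square = square"
    using assms by (auto simp: square_homeo_def bij_betw_def)
  have "compact square"
    unfolding square_def by (intro compact_Times compact_Icc)
  then have "continuous_on square (inv_into square f)"
    using continuous_on_inv[OF f(1), of "inv_into square f"] f(2,3) by (simp add: inv_into_f_f)
  then show "square_homeo (inv_into square f)"
    using assms unfolding square_homeo_def by (simp add: bij_betw_inv_into)
  show "inv_into square f (f p) = p" if "p \<in> square" for p
    using f(2) that by (rule inv_into_f_f)
  show "f (inv_into square f p) = p" if "p \<in> square" for p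
    using that f(3) by (metis f_inv_into_f)
qed

definition clamp2 :: "real \<Rightarrow> real" where
  "clamp2 z = max (-1) (min 1 (2 * z))"

text \<open>
  On each vertical segment of the square this map is affine.  The top end \<open>(z, 1)\<close> stays
  where it is, and the bottom end goes to the point with parameter \<open>z\<close> on a path which runs down
  the left side from height \<open>2c - 1\<close> to the corner, along the bottom and up the right side to height
  \<open>2c - 1\<close>.  The images of different segments do not meet.  The inverse map shrinks the two vertical
  sides to their parts above the height \<open>2c - 1\<close>, and it moves the two lower corners into the open
  bottom side.
\<close>

definition spread :: "real \<Rightarrow> real \<times> real \<Rightarrow> real \<times> real" where
  "spread c = (\<lambda>(z, y). let s = (1 + y) / 2 in
     ((1 - s) * clamp2 z + s * z, 2 * (s + (1 - s) * (c * max 0 (2 * \<bar>z\<bar> - 1))) - 1))"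

lemma spread_eq: "spread c (z, 2 * s - 1) =
   ((1 - s) * clamp2 z + s * z, 2 * (s + (1 - s) * (c * max 0 (2 * \<bar>z\<bar> - 1))) - 1)"
  by (simp add: spread_def Let_def)

lemma spread_reflect: "spread c (- z, y) = (- fst (spread c (z, y)), snd (spread c (z, y)))"
proof -
  have "clamp2 (- z) = - clamp2 z" by (simp add: clamp2_def)
  then show ?thesis
    unfolding spread_def Let_def case_prod_conv fst_conv snd_conv
    by (simp only: abs_minus mult_minus_right minus_add_distrib)
qed

text \<open>
  In the right half of the square the second coordinate of the image increases with the height \<open>s\<close>
  and with \<open>z\<close>, whereas the first one decreases with \<open>s\<close> and increases with \<open>z\<close>.  Two points with
  the same image therefore have the same height.
\<close>

lemma spread_inj_nonneg:
  assumes c: "0 < c" "c < 1" and z: "0 \<le> z" "z \<le> 1" "0 \<le> w" "w \<le> 1"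
    and s: "0 \<le> s" "s \<le> t" "t \<le> 1"
    and a: "(1 - s) * clamp2 z + s * z = (1 - t) * clamp2 w + t * w"
    and b: "s + (1 - s) * (c * max 0 (2 * z - 1)) = t + (1 - t) * (c * max 0 (2 * w - 1))"
  shows "s = t \<and> z = w"
proof -
  have cl: "clamp2 z = min 1 (2 * z)" "clamp2 w = min 1 (2 * w)"
    using z by (auto simp: clamp2_def)
  have strict: "(1 - t) * clamp2 u + t * u < (1 - t) * clamp2 v + t * v" if "0 < t" "u < v" for u v
  proof -
    have "(1 - t) * clamp2 u \<le> (1 - t) * clamp2 v"
      using s that by (auto simp: clamp2_def intro!: mult_left_mono)
    moreover have "t * u < t * v" using that by simp
    ultimately show ?thesis by linarith
  qed
  have st: "s = t"
  proof (rule ccontr)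
    assume "s \<noteq> t"
    then have lt: "s < t" using s by simp
    have "w < z"
    proof (rule ccontr)
      assume "\<not> w < z"
      define m where "m = c * max 0 (2 * z - 1)"
      define m' where "m' = c * max 0 (2 * w - 1)"
      have "max 0 (2 * z - 1) \<le> max 0 (2 * w - 1)" "max 0 (2 * z - 1) \<le> 1"
        using \<open>\<not> w < z\<close> z by auto
      then have m: "m \<le> m'" "0 \<le> m" "m \<le> c * 1"
        unfolding m_def m'_def using c by (auto intro!: mult_left_mono)
      have "s + (1 - s) * m = t + (1 - t) * m'"
        using b unfolding m_def m'_def .
      moreover have "(1 - t) * m \<le> (1 - t) * m'"
        using s m by (intro mult_left_mono) auto
      moreover have "s + (1 - s) * m < t + (1 - t) * m"
      proof -
        have "(t - s) * (1 - m) > 0" using lt m c by (intro mult_pos_pos) linarith+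
        then show ?thesis by (simp add: algebra_simps)
      qed
      ultimately show False by linarith
    qed
    then have "(1 - t) * clamp2 w + t * w < (1 - t) * clamp2 z + t * z"
      using strict lt s by simp
    moreover have "(1 - t) * clamp2 z + t * z \<le> (1 - s) * clamp2 z + s * z"
    proof -
      have "(t - s) * (clamp2 z - z) \<ge> 0" using lt z by (intro mult_nonneg_nonneg) (auto simp: cl)
      then show ?thesis by (simp add: algebra_simps)
    qed
    ultimately show False using a by linarith
  qed
  have "z = w"
  proof (cases "t = 0")
    case True
    then have "min 1 (2 * z) = min 1 (2 * w)" "max 0 (2 * z - 1) = max 0 (2 * w - 1)"
      using a b st c by (simp_all add: cl)
    then show ?thesis by (auto simp: min_def max_def split: if_splits)
  next
    case False
    then have "0 < t" using s st by simp
    then show ?thesis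
      using strict[of z w] strict[of w z] a st by (metis linorder_neqE_linordered_idom order_less_irrefl)
  qed
  with st show ?thesis by simp
qed

text \<open>
  A point is reached by a segment that starts either on the bottom or on the right side.  The height
  on the segment is given by an explicit formula unless the point is off the right side and its
  segment starts there; then the intermediate value theorem yields it.
\<close>

lemma spread_surj_nonneg:
  assumes c: "0 < c" "c < 1" and a: "0 \<le> a" "a \<le> 1" and b: "0 \<le> b" "b \<le> 1"
  shows "\<exists>z s. 0 \<le> z \<and> z \<le> 1 \<and> 0 \<le> s \<and> s \<le> 1 \<and> (1 - s) * clamp2 z + s * z = a \<and>
    s + (1 - s) * (c * max 0 (2 * z - 1)) = b"
proof -
  consider "a \<le> 1 - b / 2" | "1 - b / 2 < a" "a < 1" | "a = 1" "b \<le> c" | "a = 1" "c < b"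
    using a by fastforce
  then show ?thesis
  proof cases
    case 1
    define z where "z = a / (2 - b)"
    have z: "0 \<le> z" "z \<le> 1 / 2" "z * (2 - b) = a"
      using 1 a b by (auto simp: z_def field_simps)
    then have "clamp2 z = 2 * z" "max 0 (2 * z - 1) = 0" by (auto simp: clamp2_def)
    then show ?thesis
      using z b by (intro exI[of _ z] exI[of _ b]) (auto simp: algebra_simps)
  next
    case 2
    define e where "e = 1 - a"
    have e: "0 < e" "2 * e < b" using 2 by (auto simp: e_def)
    \<comment> \<open>The first coordinate is prescribed by \<open>z = 1 - e / s\<close>; the second one is then \<open>\<phi> s\<close>.\<close>
    define \<phi> where "\<phi> = (\<lambda>s. s + (1 - s) * (c * (1 - 2 * e / s)))"
    have cont: "continuous_on {2 * e..1} \<phi>"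
      unfolding \<phi>_def using e by (intro continuous_intros) auto
    have "\<phi> (2 * e) \<le> b" "b \<le> \<phi> 1" using e b by (auto simp: \<phi>_def)
    then obtain s where s: "2 * e \<le> s" "s \<le> 1" "\<phi> s = b"
      using IVT'[of \<phi> "2 * e" b 1] cont e b by auto
    define z where "z = 1 - e / s"
    have s0: "0 < s" using s e by linarith
    have z: "1 / 2 \<le> z" "z \<le> 1" "s * z = s - e" "2 * z - 1 = 1 - 2 * e / s"
      using s s0 e by (auto simp: z_def field_simps)
    have cl: "clamp2 z = 1" "max 0 (2 * z - 1) = 1 - 2 * e / s"
      using z by (auto simp: clamp2_def)
    have "(1 - s) * clamp2 z + s * z = a"
      using z(3) by (simp add: cl e_def)
    moreover have "s + (1 - s) * (c * max 0 (2 * z - 1)) = b"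
      using s(3) by (simp only: cl(2) \<phi>_def)
    ultimately show ?thesis
      using z s s0 by (intro exI[of _ z] exI[of _ s]) auto
  next
    case 3
    define z where "z = (1 + b / c) / 2"
    have bc: "0 \<le> b / c" "b / c \<le> 1" using 3(2) c(1) b(1) by (simp_all add: field_simps)
    have "2 * z = 1 + b / c" by (simp add: z_def)
    then have z: "clamp2 z = 1" "max 0 (2 * z - 1) = b / c" "0 \<le> z" "z \<le> 1"
      unfolding clamp2_def using bc by linarith+
    show ?thesis
      by (rule exI[of _ z], rule exI[of _ 0]) (use z 3 c in auto)
  next
    case 4
    define s where "s = (b - c) / (1 - c)"
    have s: "0 \<le> s" "s \<le> 1" "s * (1 - c) = b - c"
      using 4(2) c b by (simp_all add: s_def)
    have "s + (1 - s) * c = b" using s(3) by (simp add: algebra_simps)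
    then show ?thesis
      using s 4 by (intro exI[of _ 1] exI[of _ s]) (auto simp: clamp2_def)
  qed
qed

lemma spread_sign: "0 \<le> s \<Longrightarrow> s \<le> 1 \<Longrightarrow> z < 0 \<Longrightarrow> (1 - s) * clamp2 z + s * z < (0::real)"
proof -
  assume s: "0 \<le> s" "s \<le> 1" and z: "z < 0"
  have "clamp2 z \<le> z \<or> clamp2 z = -1" "clamp2 z < 0" using z by (auto simp: clamp2_def)
  show ?thesis
  proof (cases "s = 1")
    case False
    then have "(1 - s) * clamp2 z < 0" using s \<open>clamp2 z < 0\<close> by (simp add: mult_pos_neg)
    moreover have "s * z \<le> 0" using s z by (simp add: mult_nonneg_nonpos)
    ultimately show ?thesis by linarith
  qed (use z in simp)
qed

lemma square_homeo_spread:
  assumes c: "0 < c" "c < 1"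
  shows "square_homeo (spread c)"
proof -
  have mem: "spread c p \<in> square" if p: "p \<in> square" for p
  proof -
    obtain z y where zy: "p = (z, y)" "\<bar>z\<bar> \<le> 1" "0 \<le> (1 + y) / 2" "(1 + y) / 2 \<le> 1"
      using p by (auto simp: square_def)
    define s where "s = (1 + y) / 2"
    define m where "m = c * max 0 (2 * \<bar>z\<bar> - 1)"
    have s: "0 \<le> s" "s \<le> 1" using zy by (auto simp: s_def)
    have m: "0 \<le> m" "m \<le> 1"
      unfolding m_def using c zy(2) by (auto intro!: mult_le_one)
    have "\<bar>clamp2 z\<bar> \<le> 1" by (auto simp: clamp2_def)
    then have "\<bar>(1 - s) * clamp2 z\<bar> \<le> 1 - s" "\<bar>s * z\<bar> \<le> s"
      using s zy(2) by (auto simp: abs_mult intro: mult_left_le)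
    then have "\<bar>(1 - s) * clamp2 z + s * z\<bar> \<le> 1" by linarith
    moreover have "0 \<le> (1 - s) * m" "(1 - s) * m \<le> (1 - s)"
      using s m by (auto intro: mult_left_le)
    moreover have "spread c p = ((1 - s) * clamp2 z + s * z, 2 * (s + (1 - s) * m) - 1)"
      unfolding zy(1) spread_def Let_def s_def m_def by simp
    ultimately show ?thesis
      using s by (simp add: square_def abs_le_iff)
  qed
  have "inj_on (spread c) square"
  proof (rule inj_onI)
    fix p q assume p: "p \<in> square" and q: "q \<in> square" and eq: "spread c p = spread c q"
    obtain z y where zy: "p = (z, y)" "\<bar>z\<bar> \<le> 1" "\<bar>y\<bar> \<le> 1" using p by (auto simp: square_def)
    obtain w x where wx: "q = (w, x)" "\<bar>w\<bar> \<le> 1" "\<bar>x\<bar> \<le> 1" using q by (auto simp: square_def)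
    have *: "s = t \<and> z = w"
      if "0 \<le> z" "z \<le> 1" "0 \<le> w" "w \<le> 1" "0 \<le> s" "s \<le> 1" "0 \<le> t" "t \<le> 1"
        "(1 - s) * clamp2 z + s * z = (1 - t) * clamp2 w + t * w"
        "s + (1 - s) * (c * max 0 (2 * z - 1)) = t + (1 - t) * (c * max 0 (2 * w - 1))"
      for z w s t
      using spread_inj_nonneg[OF c, of z w s t] spread_inj_nonneg[OF c, of w z t s] that
      by (cases "s \<le> t") auto
    define s where "s = (1 + y) / 2"
    define t where "t = (1 + x) / 2"
    have st: "0 \<le> s" "s \<le> 1" "0 \<le> t" "t \<le> 1" using zy wx by (auto simp: s_def t_def)
    have "y = 2 * s - 1" "x = 2 * t - 1" by (auto simp: s_def t_def field_simps)
    then have eq': "spread c (z, 2 * s - 1) = spread c (w, 2 * t - 1)"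
      using eq by (simp add: zy wx)
    have cancel: "A = B" if "2 * A - 1 = 2 * B - 1" for A B :: real
      using that by simp
    have e1: "(1 - s) * clamp2 z + s * z = (1 - t) * clamp2 w + t * w"
      using eq' by (simp only: spread_eq prod.inject)
    have e2: "s + (1 - s) * (c * max 0 (2 * \<bar>z\<bar> - 1)) = t + (1 - t) * (c * max 0 (2 * \<bar>w\<bar> - 1))"
      by (rule cancel) (use eq' in \<open>simp only: spread_eq prod.inject\<close>)
    have neg: "(1 - s) * clamp2 (- z) + s * (- z) = - ((1 - s) * clamp2 z + s * z)" for z s
    proof -
      have "clamp2 (- z) = - clamp2 z" by (simp add: clamp2_def)
      then show ?thesis by simp
    qed
    have pos: "0 \<le> z" if "0 \<le> (1 - s) * clamp2 z + s * z" "0 \<le> s" "s \<le> 1" for z s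
      using spread_sign[of s z] that by (cases "0 \<le> z") auto
    have "s = t \<and> z = w"
    proof (cases "0 \<le> (1 - s) * clamp2 z + s * z")
      case True
      have n: "0 \<le> z" by (rule pos[OF True st(1,2)])
      have m: "0 \<le> w" by (rule pos[OF True[unfolded e1] st(3,4)])
      show ?thesis
      proof (rule *[OF n _ m _ st e1])
        show "s + (1 - s) * (c * max 0 (2 * z - 1)) = t + (1 - t) * (c * max 0 (2 * w - 1))"
          using e2 unfolding abs_of_nonneg[OF n] abs_of_nonneg[OF m] .
        show "z \<le> 1" "w \<le> 1" using zy(2) wx(2) by simp_all
      qed
    next
      case False
      have z: "0 \<le> (1 - s) * clamp2 (- z) + s * (- z)"
        using False unfolding neg by simp
      then have w: "0 \<le> (1 - t) * clamp2 (- w) + t * (- w)"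
        unfolding neg e1 .
      have n: "0 \<le> - z" by (rule pos[OF z st(1,2)])
      have m: "0 \<le> - w" by (rule pos[OF w st(3,4)])
      have abs: "\<bar>z\<bar> = - z" "\<bar>w\<bar> = - w" using n m by simp_all
      have "s = t \<and> - z = - w"
      proof (rule *[OF n _ m _ st])
        show "(1 - s) * clamp2 (- z) + s * - z = (1 - t) * clamp2 (- w) + t * - w"
          unfolding neg e1 ..
        show "s + (1 - s) * (c * max 0 (2 * - z - 1)) = t + (1 - t) * (c * max 0 (2 * - w - 1))"
          using e2 unfolding abs .
        show "- z \<le> 1" "- w \<le> 1" using zy(2) wx(2) by simp_all
      qed
      then show ?thesis by simp
    qed
    then show "p = q" by (simp add: zy wx s_def t_def)
  qed
  moreover have "spread c ` square = square"
  proof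
    show "spread c ` square \<subseteq> square" using mem by blast
    show "square \<subseteq> spread c ` square"
    proof
      fix p assume "p \<in> square"
      then obtain a b where ab: "p = (a, b)" "\<bar>a\<bar> \<le> 1" "0 \<le> (1 + b) / 2" "(1 + b) / 2 \<le> 1"
        by (auto simp: square_def)
      obtain z s where zs: "0 \<le> z" "z \<le> 1" "0 \<le> s" "s \<le> 1"
        "(1 - s) * clamp2 z + s * z = \<bar>a\<bar>" "s + (1 - s) * (c * max 0 (2 * z - 1)) = (1 + b) / 2"
        using spread_surj_nonneg[OF c, of "\<bar>a\<bar>" "(1 + b) / 2"] ab by auto
      have 1: "spread c (z, 2 * s - 1) = (\<bar>a\<bar>, b)"
        unfolding spread_eq abs_of_nonneg[OF zs(1)] zs(5,6) by (simp add: field_simps)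
      then have 2: "spread c (- z, 2 * s - 1) = (- \<bar>a\<bar>, b)"
        by (simp add: spread_reflect)
      have "(z, 2 * s - 1) \<in> square" "(- z, 2 * s - 1) \<in> square"
        using zs by (auto simp: square_def)
      then show "p \<in> spread c ` square"
        using 1 2 ab(1) by (cases "0 \<le> a") (force intro!: rev_image_eqI)+
    qed
  qed
  moreover have "continuous_on square (spread c)"
    unfolding spread_def Let_def clamp2_def case_prod_beta
    by (intro continuous_intros) simp_all
  ultimately show ?thesis
    by (simp add: square_homeo_def bij_betw_def)
qed

text \<open>
  The two ends of a vertical segment are moved to points whose first coordinates differ by at most
  one half of its length.  This is what makes the infinite composition \<open>rolling\<close> below invertible.
\<close>

lemma spread_contraction:
  "\<bar>fst (spread c (z, y)) - fst (spread c (z, x))\<bar> \<le> \<bar>y - x\<bar> / 2" if "\<bar>z\<bar> \<le> 1"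
proof -
  have "fst (spread c (z, y)) - fst (spread c (z, x)) = (y - x) / 2 * (z - clamp2 z)"
    by (simp add: spread_def Let_def field_simps)
  moreover have "\<bar>z - clamp2 z\<bar> \<le> 1" using that by (auto simp: clamp2_def)
  then have "\<bar>(y - x) / 2\<bar> * \<bar>z - clamp2 z\<bar> \<le> \<bar>(y - x) / 2\<bar>"
    by (intro mult_left_le) auto
  then have "\<bar>(y - x) / 2 * (z - clamp2 z)\<bar> \<le> \<bar>y - x\<bar> / 2"
    unfolding abs_mult by simp
  ultimately show ?thesis by (simp only:)
qed

lemma spread_side: "\<bar>z\<bar> = 1 \<Longrightarrow> spread c (z, y) = (z, 2 * c - 1 + (1 - c) * (1 + y))"
  by (auto simp: spread_def Let_def clamp2_def abs_if field_simps split: if_splits)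

text \<open>
  The inverse of \<open>spread\<close> shrinks the right side towards its upper corner.  Doing this twice, the
  second time upside down, shrinks it to a small segment around its midpoint.
\<close>

lemma pinch_side:
  assumes "0 < \<eta>" "\<eta> < 1"
  obtains \<theta> where "square_homeo \<theta>"
    "\<And>a b. (a, b) \<in> square \<Longrightarrow> fst (\<theta> (a, b)) = 1 \<Longrightarrow> a = 1 \<and> \<bar>b\<bar> < \<eta>"
proof -
  \<comment> \<open>After the first step the side sits above the height \<open>2c - 1 = - \<eta> / 2\<close>; the second one, with the parameter \<open>d\<close>, leaves a piece of it whose length is less than \<open>\<eta>\<close>.\<close>
  define c where "c = (1 - \<eta> / 2) / 2"
  define d where "d = 1 - \<eta> / 2"
  have cd: "0 < c" "c < 1" "0 < d" "d < 1" using assms by (auto simp: c_def d_def)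
  obtain f where f: "square_homeo f" "\<And>p. p \<in> square \<Longrightarrow> spread c (f p) = p"
    using square_homeo_inverse[OF square_homeo_spread[OF cd(1,2)]] by metis
  obtain g where g: "square_homeo g" "\<And>p. p \<in> square \<Longrightarrow> spread d (g p) = p"
    using square_homeo_inverse[OF square_homeo_spread[OF cd(3,4)]] by metis
  define R :: "real \<times> real \<Rightarrow> real \<times> real" where "R = (\<lambda>(a, b). (a, - b))"
  have R: "square_homeo R"
    unfolding square_homeo_def R_def
  proof
    show "continuous_on square (\<lambda>(a, b). (a, - b))"
      unfolding case_prod_beta by (intro continuous_intros)
    show "bij_betw (\<lambda>(a, b). (a, - b)) square square"
      by (rule bij_betw_byWitness[where f' = "\<lambda>(a, b). (a, - b)"]) (auto simp: square_def)
  qed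
  have mem: "f p \<in> square" "g p \<in> square" "R p \<in> square" if "p \<in> square" for p
    using that f(1) g(1) R by (auto simp: square_homeo_def bij_betw_def)
  show thesis
  proof
    show "square_homeo (g \<circ> (R \<circ> f))"
      by (intro square_homeo_comp f g R)
    fix a b assume ab: "(a, b) \<in> square" and one: "fst ((g \<circ> (R \<circ> f)) (a, b)) = 1"
    obtain z y where zy: "f (a, b) = (z, y)" by fastforce
    obtain w x where wx: "g (z, - y) = (w, x)" by fastforce
    have w: "w = 1" using one by (simp add: zy R_def wx)
    have "(z, - y) \<in> square" using mem(3)[OF mem(1)[OF ab]] by (simp add: zy R_def)
    then have "spread d (1, x) = (z, - y)" "(1, x) \<in> square"
      using g(2)[of "(z, - y)"] mem(2)[of "(z, - y)"] wx w by auto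
    then have zy': "z = 1" "- y = 2 * d - 1 + (1 - d) * (1 + x)" "- 1 \<le> x"
      using spread_side[of 1 d x] by (auto simp: square_def)
    have "spread c (1, y) = (a, b)"
      using f(2)[OF ab] zy zy'(1) by simp
    then have b: "a = 1" "b = 2 * c - 1 + (1 - c) * (1 + y)"
      using spread_side[of 1 c y] by auto
    have "0 \<le> (1 - d) * (1 + x)" using zy'(3) cd by simp
    then have "1 + y \<le> \<eta>" using zy'(2) by (simp add: d_def)
    moreover have "0 \<le> 1 + y" using mem(1)[OF ab] by (simp add: zy square_def)
    ultimately have "0 \<le> (1 - c) * (1 + y)" "(1 - c) * (1 + y) \<le> (1 - c) * \<eta>"
      using cd by (auto intro: mult_left_mono)
    moreover have "2 * c - 1 = - \<eta> / 2" by (simp add: c_def field_simps)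
    moreover have "(1 - c) * \<eta> < \<eta>" using cd assms by simp
    ultimately show "a = 1 \<and> \<bar>b\<bar> < \<eta>"
      using b assms unfolding abs_less_iff by linarith
  qed
qed

section \<open>Blocks of coordinates\<close>

definition pair_map :: "(real \<times> real \<Rightarrow> real \<times> real) \<Rightarrow> 'i \<Rightarrow> 'i \<Rightarrow> ('i \<Rightarrow> real) \<Rightarrow> ('i \<Rightarrow> real)" where
  "pair_map f j d x = x(j := fst (f (x j, x d)), d := snd (f (x j, x d)))"

lemma cube_pair_in_square: "x \<in> cube N \<Longrightarrow> (x j, x d) \<in> square"
  using cube_abs_le[of x N j] cube_abs_le[of x N d] by (auto simp: square_def abs_le_iff)

lemma square_homeo_mem: "square_homeo f \<Longrightarrow> p \<in> square \<Longrightarrow> f p \<in> square"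
  by (auto simp: square_homeo_def bij_betw_def)

lemma pair_map_mem:
  assumes "square_homeo f" "{j, d} \<subseteq> N" "x \<in> cube N"
  shows "pair_map f j d x \<in> cube N"
proof -
  have "f (x j, x d) \<in> square"
    by (rule square_homeo_mem[OF assms(1) cube_pair_in_square[OF assms(3)]])
  then have "\<bar>fst (f (x j, x d))\<bar> \<le> 1" "\<bar>snd (f (x j, x d))\<bar> \<le> 1"
    by (auto simp: square_def abs_le_iff)
  then show ?thesis
    using assms(2,3) by (auto simp: pair_map_def cube_def)
qed

lemma pair_map_cancel:
  assumes "j \<noteq> d" "g (f (x j, x d)) = (x j, x d)"
  shows "pair_map g j d (pair_map f j d x) = x"
proof
  have "(pair_map f j d x j, pair_map f j d x d) = f (x j, x d)"
    using assms(1) by (simp add: pair_map_def)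
  then show "pair_map g j d (pair_map f j d x) i = x i" for i
    unfolding pair_map_def[of g] using assms by (simp add: pair_map_def)
qed

lemma autohomeo_pair_map:
  assumes f: "square_homeo f" and jd: "{j, d} \<subseteq> N" "j \<noteq> d"
  shows "autohomeo N (pair_map f j d)"
proof -
  obtain g where g: "square_homeo g" "\<And>p. p \<in> square \<Longrightarrow> g (f p) = p"
      "\<And>p. p \<in> square \<Longrightarrow> f (g p) = p"
    using square_homeo_inverse[OF f] by blast
  show ?thesis
  proof (rule autohomeo_if_inverse[where g = "pair_map g j d"])
    have c: "continuous_on (cube N) (\<lambda>x. f (x j, x d))"
    proof (rule continuous_on_compose2[of square f "cube N" "\<lambda>x. (x j, x d)"])
      show "continuous_on square f" using f by (simp add: square_homeo_def)
      show "continuous_on (cube N) (\<lambda>x. (x j, x d))"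
        by (intro continuous_on_Pair continuous_on_projection)
      show "(\<lambda>x. (x j, x d)) ` cube N \<subseteq> square"
        by (rule image_subsetI) (rule cube_pair_in_square)
    qed
    show "continuous_on (cube N) (pair_map f j d)"
    proof (rule continuous_on_coordinatewise_then_product)
      fix i
      consider "i = d" | "i = j" "i \<noteq> d" | "i \<noteq> j" "i \<noteq> d" by blast
      then show "continuous_on (cube N) (\<lambda>x. pair_map f j d x i)"
        by cases (simp_all add: pair_map_def continuous_on_projection continuous_on_fst[OF c]
            continuous_on_snd[OF c])
    qed
    fix x assume x: "x \<in> cube N"
    show "pair_map f j d x \<in> cube N"
      by (rule pair_map_mem[OF f jd(1) x])
    show "pair_map g j d x \<in> cube N"
      by (rule pair_map_mem[OF g(1) jd(1) x])
    note p = cube_pair_in_square[OF x, of j d]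
    show "pair_map g j d (pair_map f j d x) = x"
      by (rule pair_map_cancel[of j d g f x, OF jd(2) g(2)[OF p]])
    show "pair_map f j d (pair_map g j d x) = x"
      by (rule pair_map_cancel[of j d f g x, OF jd(2) g(3)[OF p]])
  qed
qed

text \<open>
  A block map is an autohomeomorphism of the cube that changes the coordinates in the block \<open>B\<close> only,
  in a way that depends on \<open>B\<close> and on the coordinates in \<open>A\<close>.  It is thus a family of
  autohomeomorphisms of the factor with index set \<open>B\<close>, parametrized by the factor with index set \<open>A\<close>.
\<close>

definition block_map ::
    "'i set \<Rightarrow> 'i set \<Rightarrow> 'i set \<Rightarrow> (('i \<Rightarrow> real) \<Rightarrow> ('i \<Rightarrow> real)) \<Rightarrow> bool" where
  "block_map N A B T \<longleftrightarrow> autohomeo N T \<and> (\<forall>x\<in>cube N. \<forall>i. i \<notin> B \<longrightarrow> T x i = x i) \<and>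
     (\<forall>x\<in>cube N. \<forall>y\<in>cube N. (\<forall>i\<in>A \<union> B. x i = y i) \<longrightarrow> (\<forall>i\<in>B. T x i = T y i))"

lemma block_mapD:
  assumes "block_map N A B T"
  shows "autohomeo N T"
    and "\<And>x i. x \<in> cube N \<Longrightarrow> i \<notin> B \<Longrightarrow> T x i = x i"
    and "\<And>x y i. x \<in> cube N \<Longrightarrow> y \<in> cube N \<Longrightarrow> (\<And>i. i \<in> A \<union> B \<Longrightarrow> x i = y i) \<Longrightarrow> i \<in> B \<Longrightarrow> T x i = T y i"
proof -
  note * = assms[unfolded block_map_def]
  show "autohomeo N T" by (rule conjunct1[OF *])
  show "T x i = x i" if "x \<in> cube N" "i \<notin> B" for x i
    by (rule mp[OF spec[OF bspec[OF conjunct1[OF conjunct2[OF *]] that(1)]] that(2)])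
  show "T x i = T y i" if "x \<in> cube N" "y \<in> cube N" "\<And>i. i \<in> A \<union> B \<Longrightarrow> x i = y i" "i \<in> B" for x y i
    by (rule bspec[OF mp[OF bspec[OF bspec[OF conjunct2[OF conjunct2[OF *]] that(1)] that(2)]] that(4)])
      (simp add: that(3))
qed

lemma block_mapI:
  assumes "autohomeo N T"
    and "\<And>x i. x \<in> cube N \<Longrightarrow> i \<notin> B \<Longrightarrow> T x i = x i"
    and "\<And>x y i. x \<in> cube N \<Longrightarrow> y \<in> cube N \<Longrightarrow> (\<And>i. i \<in> A \<union> B \<Longrightarrow> x i = y i) \<Longrightarrow> i \<in> B \<Longrightarrow> T x i = T y i"
  shows "block_map N A B T"
  unfolding block_map_def
proof (intro conjI ballI allI impI)
  fix x y i assume "x \<in> cube N" "y \<in> cube N" "\<forall>i\<in>A \<union> B. x i = y i" "i \<in> B"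
  then show "T x i = T y i" by (intro assms(3)[of x y]) blast+
qed (fact assms)+

lemma block_map_comp:
  assumes S: "block_map N A B S" and T: "block_map N A B T"
  shows "block_map N A B (\<lambda>x. T (S x))"
proof (rule block_mapI)
  show "autohomeo N (\<lambda>x. T (S x))"
    by (rule autohomeo_comp[OF block_mapD(1)[OF S] block_mapD(1)[OF T]])
  note mem = autohomeo_mem[OF block_mapD(1)[OF S]]
  show "T (S x) i = x i" if "x \<in> cube N" "i \<notin> B" for x i
    using block_mapD(2)[OF T mem that(2)] block_mapD(2)[OF S that] that by simp
  fix x y i assume xy: "x \<in> cube N" "y \<in> cube N" "\<And>i. i \<in> A \<union> B \<Longrightarrow> x i = y i" and i: "i \<in> B"
  show "T (S x) i = T (S y) i"
  proof (rule block_mapD(3)[OF T mem[OF xy(1)] mem[OF xy(2)] _ i])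
    fix k assume k: "k \<in> A \<union> B"
    show "S x k = S y k"
    proof (cases "k \<in> B")
      case True
      show ?thesis by (rule block_mapD(3)[OF S xy(1,2) xy(3) True])
    next
      case False
      show ?thesis
        using block_mapD(2)[OF S xy(1) False] block_mapD(2)[OF S xy(2) False] xy(3)[OF k] by simp
    qed
  qed
qed

lemma block_map_pair_map:
  assumes "square_homeo f" "{j, d} \<subseteq> B" "B \<subseteq> N" "j \<noteq> d"
  shows "block_map N A B (pair_map f j d)"
proof (rule block_mapI)
  show "autohomeo N (pair_map f j d)"
    using assms by (intro autohomeo_pair_map) auto
  show "pair_map f j d x i = x i" if "i \<notin> B" for x i
    using that assms(2) by (auto simp: pair_map_def)
  fix x y :: "'a \<Rightarrow> real" and i
  assume xy: "\<And>i. i \<in> A \<union> B \<Longrightarrow> x i = y i" and i: "i \<in> B"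
  have "x i = y i" "x j = y j" "x d = y d" using xy i assms(2) by auto
  then show "pair_map f j d x i = pair_map f j d y i"
    by (simp add: pair_map_def)
qed

text \<open>
  Pinching the pairs of coordinates \<open>(j, d)\<close> one after the other, a point can reach the face \<open>x j = 1\<close>
  only if it lies on this face at the beginning and if all its coordinates \<open>x d\<close> are small.
\<close>

lemma pinch_face:
  assumes "finite D" "insert j D \<subseteq> B" "B \<subseteq> N" "j \<notin> D" "0 < \<eta>" "\<eta> < 1"
  shows "\<exists>T. block_map N A B T \<and> (\<forall>x\<in>cube N. T x j = 1 \<longrightarrow> x j = 1 \<and> (\<forall>d\<in>D. \<bar>x d\<bar> < \<eta>))"
  using assms(1,2,4)
proof (induction D)
  case empty
  have "block_map N A B (\<lambda>x. x)"
    by (rule block_mapI) (auto simp: autohomeo_id)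
  then show ?case by auto
next
  case (insert d D)
  obtain T where T: "block_map N A B T"
    "\<And>x. x \<in> cube N \<Longrightarrow> T x j = 1 \<Longrightarrow> x j = 1 \<and> (\<forall>d\<in>D. \<bar>x d\<bar> < \<eta>)"
    using insert by auto
  obtain \<theta> where \<theta>: "square_homeo \<theta>"
    "\<And>a b. (a, b) \<in> square \<Longrightarrow> fst (\<theta> (a, b)) = 1 \<Longrightarrow> a = 1 \<and> \<bar>b\<bar> < \<eta>"
    using pinch_side[OF assms(5,6)] by blast
  have jd: "j \<noteq> d" using insert by auto
  have P: "block_map N A B (pair_map \<theta> j d)"
    by (rule block_map_pair_map[OF \<theta>(1) _ assms(3) jd]) (use insert in auto)
  have "x j = 1 \<and> (\<forall>e\<in>insert d D. \<bar>x e\<bar> < \<eta>)"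
    if x: "x \<in> cube N" and 1: "T (pair_map \<theta> j d x) j = 1" for x
  proof -
    have *: "pair_map \<theta> j d x j = 1 \<and> (\<forall>e\<in>D. \<bar>pair_map \<theta> j d x e\<bar> < \<eta>)"
      by (rule T(2)[OF autohomeo_mem[OF block_mapD(1)[OF P] x] 1])
    then have "x j = 1 \<and> \<bar>x d\<bar> < \<eta>"
      using \<theta>(2)[OF cube_pair_in_square[OF x, of j d]] jd by (simp add: pair_map_def)
    moreover have "pair_map \<theta> j d x e = x e" if "e \<in> D" for e
    proof -
      have "e \<noteq> j" "e \<noteq> d" using that insert by auto
      then show ?thesis by (simp add: pair_map_def)
    qed
    ultimately show ?thesis using * by auto
  qed
  with block_map_comp[OF P T(1)] show ?case by blast
qed

lemma vadd_lower_bound: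
  assumes "\<bar>x\<bar> \<le> 1" "\<bar>u\<bar> < 1"
  shows "\<bar>x - u\<bar> / 2 \<le> \<bar>vadd x (- u)\<bar>"
proof -
  have p: "0 < 1 + x * - u" "0 < 1 + x * u"
    using vadd_denom_pos[of x "- u"] vadd_denom_pos[of x u] assms by auto
  then have "\<bar>x - u\<bar> * (1 + x * - u) \<le> \<bar>x - u\<bar> * 2"
    by (intro mult_left_mono) auto
  then have "\<bar>x - u\<bar> / 2 \<le> \<bar>x - u\<bar> / (1 + x * - u)"
    by (simp only: pos_le_divide_eq[OF p(1)]) simp
  also have "\<dots> = \<bar>vadd x (- u)\<bar>"
    unfolding vadd_def abs_divide abs_of_pos[OF p(1)] by simp
  finally show ?thesis .
qed

text \<open>
  Compactness replaces the statement that no member of \<open>K\<close> is zero by a uniform one in finitely many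
  coordinates.
\<close>

lemma finite_coordinates_separating:
  fixes K :: "('i \<Rightarrow> real) set"
  assumes K: "compact K" and ne: "\<And>k. k \<in> K \<Longrightarrow> \<exists>i\<in>M. k i \<noteq> 0"
  obtains D \<epsilon> where "finite D" "D \<subseteq> M" "0 < \<epsilon>" "\<epsilon> \<le> (1::real)" "\<And>k. k \<in> K \<Longrightarrow> \<exists>i\<in>D. \<epsilon> < \<bar>k i\<bar>"
proof -
  define U where "U = (\<lambda>(i, n::nat). {k::'i \<Rightarrow> real. 1 / real (Suc n) < \<bar>k i\<bar>})"
  have op: "open (U p)" for p
    unfolding U_def case_prod_beta
    by (intro open_Collect_less continuous_intros continuous_on_projection)
  have cov: "K \<subseteq> (\<Union>p\<in>M \<times> UNIV. U p)"
  proof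
    fix k assume "k \<in> K"
    then obtain i where i: "i \<in> M" "k i \<noteq> 0" using ne by blast
    then obtain n where "1 / real (Suc n) < \<bar>k i\<bar>"
      using nat_approx_posE[of "\<bar>k i\<bar>"] by auto
    then show "k \<in> (\<Union>p\<in>M \<times> UNIV. U p)"
      using i by (auto simp: U_def)
  qed
  obtain C where C: "C \<subseteq> M \<times> UNIV" "finite C" "K \<subseteq> (\<Union>p\<in>C. U p)"
    using compactE_image[OF K, of "M \<times> UNIV" U] op cov by blast
  define m where "m = Max (insert 0 (snd ` C))"
  have m: "n \<le> m" if "(i, n) \<in> C" for i n
    unfolding m_def using C(2) that by (intro Max_ge) force+
  show thesis
  proof (rule that)
    show "finite (fst ` C)" "fst ` C \<subseteq> M" using C by auto
    show "0 < 1 / real (Suc m)" "1 / real (Suc m) \<le> 1" by auto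
    fix k assume "k \<in> K"
    then obtain i n where in_C: "(i, n) \<in> C" and k: "1 / real (Suc n) < \<bar>k i\<bar>"
      using C(3) by (fastforce simp: U_def)
    have "1 / real (Suc m) \<le> 1 / real (Suc n)"
      using m[OF in_C] by (simp add: frac_le)
    then show "\<exists>i\<in>fst ` C. 1 / real (Suc m) < \<bar>k i\<bar>"
      using k in_C by (intro bexI[of _ i]) force+
  qed
qed

definition trunc :: "'i set \<Rightarrow> ('i \<Rightarrow> real) \<Rightarrow> ('i \<Rightarrow> real)" where
  "trunc A x = (\<lambda>i. if i \<in> A then x i else 0)"

lemma continuous_on_trunc: "continuous_on S (trunc A)"
proof (rule continuous_on_coordinatewise_then_product)
  show "continuous_on S (\<lambda>x. trunc A x i)" for i
    by (cases "i \<in> A") (simp_all add: trunc_def continuous_on_projection)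
qed

lemma trunc_mem: "x \<in> cube N \<Longrightarrow> trunc A x \<in> cube N"
  by (auto simp: cube_def trunc_def)

text \<open>
  The map \<open>f\<close>, composed with the retraction onto the points vanishing outside \<open>A\<close>, becomes a section
  \<open>s\<close> of the projection to the coordinates in \<open>A\<close>.  As its image misses \<open>Z\<close> and \<open>Z\<close> is compact,
  finitely many further coordinates \<open>D\<close> suffice to tell \<open>z\<close> from \<open>s z\<close> for all \<open>z \<in> Z\<close>.  A shift of
  these coordinates moves the section to the centre of the \<open>D\<close>-cube, and then \<open>Z\<close> stays away from this
  centre.  With one more coordinate \<open>j\<close> the face \<open>x j = 1\<close> can be pinched towards the centre of the
  \<open>D\<close>-cube, where it does not meet \<open>Z\<close>.
\<close>

lemma block_off_face:
  assumes Z: "compact Z" "Z \<subseteq> cube N"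
    and A: "A \<subseteq> N" "infinite (N - A)"
    and f: "continuous_on (cube N) f" "\<And>x. x \<in> cube N \<Longrightarrow> f x \<in> cube N"
      "\<And>x i. x \<in> cube N \<Longrightarrow> i \<in> A \<Longrightarrow> f x i = x i" "\<And>x. x \<in> cube N \<Longrightarrow> f x \<notin> Z"
  shows "\<exists>B j T. finite B \<and> B \<subseteq> N - A \<and> j \<in> B \<and> block_map N A B T \<and> (\<forall>z\<in>Z. T z j < 1)"
proof -
  define s where "s = (\<lambda>x. f (trunc A x))"
  have s_cont: "continuous_on (cube N) s"
    unfolding s_def
    by (rule continuous_on_compose2[OF f(1) continuous_on_trunc]) (auto simp: trunc_mem)
  have s_mem: "s x \<in> cube N" if "x \<in> cube N" for x
    unfolding s_def by (rule f(2)[OF trunc_mem[OF that]])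
  have s_dep: "s x = s y" if "\<And>i. i \<in> A \<Longrightarrow> x i = y i" for x y
  proof -
    have "trunc A x = trunc A y" using that by (auto simp: trunc_def)
    then show ?thesis by (simp add: s_def)
  qed
  have diff: "\<exists>i\<in>N - A. s z i - z i \<noteq> 0" if z: "z \<in> Z" for z
  proof (rule ccontr)
    assume neg: "\<not> ?thesis"
    have zc: "z \<in> cube N" using z Z by auto
    have "s z = z"
    proof
      fix i
      consider "i \<notin> N" | "i \<in> A" | "i \<in> N - A" by blast
      then show "s z i = z i"
      proof cases
        case 1
        then show ?thesis using cube_off[OF s_mem[OF zc]] cube_off[OF zc] by simp
      next
        case 2
        then show ?thesis using f(3)[OF trunc_mem[OF zc]] by (simp add: s_def trunc_def)
      qed (use neg in auto)
    qed
    then show False using f(4)[OF trunc_mem[OF zc, of A]] z by (simp add: s_def)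
  qed
  define K where "K = (\<lambda>z i. s z i - z i) ` Z"
  have K: "compact K"
    unfolding K_def
  proof (rule compact_continuous_image[OF _ Z(1)])
    show "continuous_on Z (\<lambda>z i. s z i - z i)"
      by (rule continuous_on_coordinatewise_then_product)
        (rule continuous_on_diff[OF continuous_on_coordinate[OF continuous_on_subset[OF s_cont Z(2)]]
            continuous_on_projection])
  qed
  have "\<exists>i\<in>N - A. k i \<noteq> 0" if "k \<in> K" for k
    using that unfolding K_def by (elim imageE) (simp only: diff)
  then obtain D \<epsilon> where D: "finite D" "D \<subseteq> N - A" "0 < \<epsilon>" "\<epsilon> \<le> (1::real)"
    "\<And>k. k \<in> K \<Longrightarrow> \<exists>i\<in>D. \<epsilon> < \<bar>k i\<bar>"
    using finite_coordinates_separating[OF K, of "N - A"] by metis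
  have "infinite (N - A - D)" using A(2) D(1) by (rule Diff_infinite_finite[rotated])
  then obtain j where j: "j \<in> N - A - D" by (metis equals0I finite.emptyI)
  define B where "B = insert j D"
  \<comment> \<open>Shifts need amounts in the open interval; the factor costs at most half of the distance \<open>\<epsilon>\<close>.\<close>
  define c where "c = (\<lambda>i x. (1 - \<epsilon> / 2) * s x i)"
  have c_less: "\<bar>c i x\<bar> < 1" if "x \<in> cube N" for i x
  proof -
    have "\<bar>c i x\<bar> \<le> (1 - \<epsilon> / 2) * 1"
      unfolding c_def abs_mult using D cube_abs_le[OF s_mem[OF that]] by (intro mult_mono) auto
    then show ?thesis using D by simp
  qed
  have c_dep: "c i x = c i y" if "\<And>k. k \<notin> D \<Longrightarrow> x k = y k" for i x y
  proof -
    have "s x = s y" by (rule s_dep) (use that D in blast)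
    then show ?thesis by (simp add: c_def)
  qed
  have sd: "shift_data N D c"
    unfolding shift_data_def
  proof (intro conjI ballI impI)
    show "D \<subseteq> N" using D by auto
    show "continuous_on (cube N) (c i)" for i
      unfolding c_def by (rule continuous_on_mult[OF continuous_on_const continuous_on_coordinate[OF s_cont]])
    show "\<bar>c i x\<bar> < 1" if "x \<in> cube N" for i x by (rule c_less[OF that])
    show "c i x = c i y" if "\<forall>k. k \<notin> D \<longrightarrow> x k = y k" for i x y
      by (rule c_dep) (simp add: that)
  qed
  define S where "S = shift D (\<lambda>i x. - c i x)"
  have S: "block_map N A B S"
  proof (rule block_mapI)
    show "autohomeo N S"
      unfolding S_def by (rule autohomeo_shift[OF shift_data_uminus[OF sd]])
    show "S x i = x i" if "i \<notin> B" for x i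
      using that by (simp add: S_def shift_def B_def)
    fix x y :: "'a \<Rightarrow> real" and i
    assume xy: "\<And>i. i \<in> A \<union> B \<Longrightarrow> x i = y i" and i: "i \<in> B"
    have "s x = s y" by (rule s_dep) (simp add: xy)
    then show "S x i = S y i" using xy[of i] i by (simp add: S_def shift_def c_def)
  qed
  obtain T where T: "block_map N A B T"
    "\<And>x. x \<in> cube N \<Longrightarrow> T x j = 1 \<Longrightarrow> (\<forall>d\<in>D. \<bar>x d\<bar> < \<epsilon> / 4)"
  proof -
    have "insert j D \<subseteq> B" "B \<subseteq> N" "j \<notin> D" "0 < \<epsilon> / 4" "\<epsilon> / 4 < 1"
      using D(2-4) j by (auto simp: B_def)
    then show ?thesis using pinch_face[OF D(1)] that by metis
  qed
  have "T (S z) j < 1" if z: "z \<in> Z" for z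
  proof (rule ccontr)
    assume "\<not> ?thesis"
    moreover have zc: "z \<in> cube N" using z Z by auto
    then have Sz: "S z \<in> cube N" by (rule autohomeo_mem[OF block_mapD(1)[OF S]])
    then have "\<bar>T (S z) j\<bar> \<le> 1" by (intro cube_abs_le[OF autohomeo_mem[OF block_mapD(1)[OF T(1)]]])
    ultimately have "T (S z) j = 1" by simp
    then have small: "\<bar>S z d\<bar> < \<epsilon> / 4" if "d \<in> D" for d using T(2)[OF Sz] that by blast
    obtain d where d: "d \<in> D" "\<epsilon> < \<bar>s z d - z d\<bar>" using D(5)[of "\<lambda>i. s z i - z i"] z unfolding K_def by blast
    have "\<bar>s z d - c d z\<bar> \<le> \<epsilon> / 2"
    proof -
      have "s z d - c d z = \<epsilon> / 2 * s z d" by (simp add: c_def algebra_simps)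
      then show ?thesis
        using cube_abs_le[OF s_mem[OF zc], of d] D(3) by (simp only: abs_mult) (simp add: mult_left_le)
    qed
    then have "\<epsilon> / 2 < \<bar>z d - c d z\<bar>" using d(2) by linarith
    moreover have "\<bar>z d - c d z\<bar> / 2 \<le> \<bar>S z d\<bar>"
      using vadd_lower_bound[OF cube_abs_le[OF zc] c_less[OF zc]] d(1) by (simp add: S_def shift_def)
    moreover have False if "\<epsilon> / 2 < A" "A / 2 \<le> B" "B < \<epsilon> / 4" for A B :: real
      using that by linarith
    ultimately show False using small[OF d(1)] by blast
  qed
  with block_map_comp[OF S T(1)] show ?thesis
    using D j by (intro exI[of _ B] exI[of _ j] exI[of _ "\<lambda>x. T (S x)"]) (auto simp: B_def)
qed

section \<open>Transfinite products of block maps\<close>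

text \<open>
  Block maps along a well-order, each parametrized by the blocks before it, can be applied
  simultaneously: every new coordinate is computed from the old coordinates by one block map.  A
  point is recovered from its image block by block, by recursion along the well-order, because the
  parameters of a block are known once all earlier blocks have been recovered.
\<close>

lemma transfinite_block_product:
  fixes r :: "'k rel"
  assumes r: "Well_order r"
    and T: "\<And>\<alpha>. \<alpha> \<in> Field r \<Longrightarrow> block_map N (\<Union>\<beta>\<in>underS r \<alpha>. B \<beta>) (B \<alpha>) (T \<alpha>)"
    and B: "\<And>\<alpha>. \<alpha> \<in> Field r \<Longrightarrow> B \<alpha> \<subseteq> N - (\<Union>\<beta>\<in>underS r \<alpha>. B \<beta>)"
  shows "\<exists>G. autohomeo N G \<and> (\<forall>x\<in>cube N. \<forall>\<alpha>\<in>Field r. \<forall>i\<in>B \<alpha>. G x i = T \<alpha> x i)"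
proof -
  define A where "A = (\<lambda>\<alpha>. \<Union>\<beta>\<in>underS r \<alpha>. B \<beta>)"
  define I where "I = (\<Union>\<alpha>\<in>Field r. B \<alpha>)"
  define b where "b = (\<lambda>i. SOME \<alpha>. \<alpha> \<in> Field r \<and> i \<in> B \<alpha>)"
  have wf: "wf (r - Id)" using r by (simp add: well_order_on_def)
  have underS_Field: "\<beta> \<in> Field r" "(\<beta>, \<alpha>) \<in> r - Id" if "\<beta> \<in> underS r \<alpha>" for \<alpha> \<beta>
    using that by (auto simp: underS_def Field_def)
  have T': "block_map N (A \<alpha>) (B \<alpha>) (T \<alpha>)" and BA: "B \<alpha> \<inter> A \<alpha> = {}" and BN: "B \<alpha> \<subseteq> N"
    if "\<alpha> \<in> Field r" for \<alpha>
    using T[OF that] B[OF that] by (auto simp: A_def)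
  have AB: "i \<notin> B \<alpha>" if "\<alpha> \<in> Field r" "i \<in> A \<alpha>" for i \<alpha>
    using BA[OF that(1)] that(2) by blast
  have disj: "\<alpha> = \<beta>" if "\<alpha> \<in> Field r" "\<beta> \<in> Field r" "i \<in> B \<alpha>" "i \<in> B \<beta>" for i \<alpha> \<beta>
  proof (rule ccontr)
    assume "\<alpha> \<noteq> \<beta>"
    then have "\<alpha> \<in> underS r \<beta> \<or> \<beta> \<in> underS r \<alpha>"
      using r that(1,2)
      by (auto simp: underS_def well_order_on_def linear_order_on_def total_on_def)
    then show False
      using AB[OF that(1), of i] AB[OF that(2), of i] that(3,4) by (auto simp: A_def)
  qed
  have b: "b i \<in> Field r \<and> i \<in> B (b i)" if "i \<in> I" for i
    unfolding b_def by (rule someI_ex) (use that in \<open>auto simp: I_def\<close>)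
  have b_eq: "b i = \<alpha>" if "\<alpha> \<in> Field r" "i \<in> B \<alpha>" for i \<alpha>
  proof -
    have "i \<in> I" using that by (auto simp: I_def)
    then show ?thesis using b disj that by blast
  qed
  have bA: "i \<in> I" "b i \<in> underS r \<alpha>" if iA: "i \<in> A \<alpha>" for i \<alpha>
  proof -
    obtain \<beta> where \<beta>: "\<beta> \<in> underS r \<alpha>" "i \<in> B \<beta>" using iA by (auto simp: A_def)
    then show "i \<in> I" using underS_Field(1)[OF \<beta>(1)] by (auto simp: I_def)
    show "b i \<in> underS r \<alpha>" using b_eq[OF underS_Field(1)[OF \<beta>(1)] \<beta>(2)] \<beta>(1) by simp
  qed
  have Tm: "T \<alpha> x \<in> cube N" if "\<alpha> \<in> Field r" "x \<in> cube N" for \<alpha> x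
    by (rule autohomeo_mem[OF block_mapD(1)[OF T'[OF that(1)]] that(2)])
  define G where "G = (\<lambda>x i. if i \<in> I then T (b i) x i else x i)"
  have G: "G x i = T \<alpha> x i" if "\<alpha> \<in> Field r" "i \<in> B \<alpha>" for x i \<alpha>
  proof -
    have "i \<in> I" using that by (auto simp: I_def)
    then show ?thesis using b_eq[OF that] by (simp add: G_def)
  qed
  have G_mem: "G x \<in> cube N" if x: "x \<in> cube N" for x
  proof (rule cubeI)
    fix i
    show "\<bar>G x i\<bar> \<le> 1"
      using cube_abs_le[OF x] cube_abs_le[OF Tm[OF _ x]] b by (simp add: G_def)
  next
    fix i assume "i \<notin> N"
    moreover have "i \<in> N" if "i \<in> I" using b[OF that] BN by blast
    ultimately show "G x i = 0" using cube_off[OF x] by (auto simp: G_def)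
  qed
  have G_cont: "continuous_on (cube N) G"
  proof (rule continuous_on_coordinatewise_then_product)
    fix i
    show "continuous_on (cube N) (\<lambda>x. G x i)"
    proof (cases "i \<in> I")
      case True
      have "continuous_on (cube N) (T (b i))"
        using block_mapD(1)[OF T'[OF conjunct1[OF b[OF True]]]] by (simp add: autohomeo_def)
      then show ?thesis using True by (simp add: G_def continuous_on_coordinate)
    qed (simp add: G_def continuous_on_projection)
  qed
  have inj: "inj_on G (cube N)"
  proof (rule inj_onI)
    fix x y assume x: "x \<in> cube N" and y: "y \<in> cube N" and eq: "G x = G y"
    have agree: "\<alpha> \<in> Field r \<longrightarrow> (\<forall>i\<in>B \<alpha>. x i = y i)" for \<alpha>
    proof (induction \<alpha> rule: wf_induct_rule[OF wf])
      case (1 \<alpha>)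
      show ?case
      proof
        assume \<alpha>: "\<alpha> \<in> Field r"
        have on_A: "x i = y i" if "i \<in> A \<alpha>" for i
          using 1 underS_Field that unfolding A_def by blast
        \<comment> \<open>Only the block \<open>B \<alpha>\<close> is exchanged, so that the injectivity of \<open>T \<alpha>\<close> applies to \<open>w\<close> and \<open>y\<close>.\<close>
        define w where "w = (\<lambda>i. if i \<in> B \<alpha> then x i else y i)"
        have w: "w \<in> cube N" unfolding w_def by (rule cube_override[OF x y])
        have "T \<alpha> w i = T \<alpha> y i" for i
        proof (cases "i \<in> B \<alpha>")
          case True
          have "T \<alpha> w i = T \<alpha> x i"
            by (rule block_mapD(3)[OF T'[OF \<alpha>] w x _ True]) (auto simp: w_def on_A)
          then show ?thesis
            using fun_cong[OF eq, of i] by (simp add: G[OF \<alpha> True])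
        next
          case False
          then show ?thesis
            using block_mapD(2)[OF T'[OF \<alpha>] w False] block_mapD(2)[OF T'[OF \<alpha>] y False]
            by (simp add: w_def)
        qed
        then have "w = y"
          by (intro autohomeo_inj[OF block_mapD(1)[OF T'[OF \<alpha>]] w y] ext)
        then show "\<forall>i\<in>B \<alpha>. x i = y i" by (auto simp: w_def fun_eq_iff split: if_splits)
      qed
    qed
    show "x = y"
    proof
      fix i
      show "x i = y i"
      proof (cases "i \<in> I")
        case True
        then show ?thesis using agree b by blast
      next
        case False
        then show ?thesis using fun_cong[OF eq, of i] by (simp add: G_def)
      qed
    qed
  qed
  have surj: "\<exists>x\<in>cube N. G x = y" if y: "y \<in> cube N" for y
  proof -
    \<comment> \<open>The preimage is built from points \<open>X \<alpha>\<close> of which only the coordinates in the block \<open>B \<alpha>\<close> are kept.\<close>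
    define target where "target = (\<lambda>X \<alpha> i. if i \<in> A \<alpha> then X (b i) i else y i)"
    have "\<exists>X. \<forall>\<alpha>. \<alpha> \<in> Field r \<longrightarrow> X \<alpha> \<in> cube N \<and> T \<alpha> (X \<alpha>) = target X \<alpha>"
    proof (rule dependent_wf_choice[OF wf])
      fix f g :: "'k \<Rightarrow> 'a \<Rightarrow> real" and \<alpha> v
      assume "\<And>z. (z, \<alpha>) \<in> r - Id \<Longrightarrow> f z = g z"
      then have "f (b i) = g (b i)" if "i \<in> A \<alpha>" for i
        using underS_Field(2)[OF bA(2)[OF that]] by simp
      then have "target f \<alpha> = target g \<alpha>" by (auto simp: target_def)
      then show "(\<alpha> \<in> Field r \<longrightarrow> v \<in> cube N \<and> T \<alpha> v = target f \<alpha>) =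
          (\<alpha> \<in> Field r \<longrightarrow> v \<in> cube N \<and> T \<alpha> v = target g \<alpha>)" by simp
    next
      fix \<alpha> f
      assume IH: "\<And>\<beta>. (\<beta>, \<alpha>) \<in> r - Id \<Longrightarrow> \<beta> \<in> Field r \<longrightarrow> f \<beta> \<in> cube N \<and> T \<beta> (f \<beta>) = target f \<beta>"
      show "\<exists>v. \<alpha> \<in> Field r \<longrightarrow> v \<in> cube N \<and> T \<alpha> v = target f \<alpha>"
      proof (cases "\<alpha> \<in> Field r")
        case True
        have f: "f (b i) \<in> cube N" if "i \<in> A \<alpha>" for i
          using IH[OF underS_Field(2)[OF bA(2)[OF that]]] b[OF bA(1)[OF that]] by blast
        have "target f \<alpha> \<in> cube N"
        proof (rule cubeI)
          show "\<bar>target f \<alpha> i\<bar> \<le> 1" for i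
            using cube_abs_le[OF f, of i i] cube_abs_le[OF y] by (simp add: target_def)
          show "target f \<alpha> i = 0" if "i \<notin> N" for i
            using cube_off[OF f, of i i] cube_off[OF y] that by (simp add: target_def)
        qed
        then show ?thesis
          using block_mapD(1)[OF T'[OF True]] by (metis autohomeo_inverse autohomeo_mem)
      qed simp
    qed
    then obtain X where X: "\<And>\<alpha>. \<alpha> \<in> Field r \<Longrightarrow> X \<alpha> \<in> cube N"
      "\<And>\<alpha>. \<alpha> \<in> Field r \<Longrightarrow> T \<alpha> (X \<alpha>) = target X \<alpha>" by blast
    define x where "x = (\<lambda>i. if i \<in> I then X (b i) i else y i)"
    have x: "x \<in> cube N"
    proof (rule cubeI)
      show "\<bar>x i\<bar> \<le> 1" for i
        using cube_abs_le[OF X(1)] b cube_abs_le[OF y] by (simp add: x_def)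
      show "x i = 0" if "i \<notin> N" for i
        using cube_off[OF X(1) that] b cube_off[OF y that] by (simp add: x_def)
    qed
    have x_eq: "x i = X \<alpha> i" if \<alpha>: "\<alpha> \<in> Field r" and i: "i \<in> A \<alpha> \<union> B \<alpha>" for \<alpha> i
    proof (cases "i \<in> B \<alpha>")
      case True
      then have "i \<in> I" using \<alpha> by (auto simp: I_def)
      then show ?thesis using b_eq[OF \<alpha> True] by (simp add: x_def)
    next
      case False
      then have iA: "i \<in> A \<alpha>" using i by blast
      have "X \<alpha> i = T \<alpha> (X \<alpha>) i"
        using block_mapD(2)[OF T'[OF \<alpha>] X(1)[OF \<alpha>] False] by simp
      also have "\<dots> = X (b i) i" using iA by (simp add: X(2)[OF \<alpha>] target_def)
      finally show ?thesis using bA(1)[OF iA] by (simp add: x_def)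
    qed
    have "G x i = y i" for i
    proof (cases "i \<in> I")
      case True
      define \<alpha> where "\<alpha> = b i"
      have \<alpha>: "\<alpha> \<in> Field r" and i: "i \<in> B \<alpha>" using b[OF True] by (auto simp: \<alpha>_def)
      have "G x i = T \<alpha> x i" by (rule G[OF \<alpha> i])
      also have "\<dots> = T \<alpha> (X \<alpha>) i"
        by (rule block_mapD(3)[OF T'[OF \<alpha>] x X(1)[OF \<alpha>] x_eq[OF \<alpha>] i])
      also have "\<dots> = y i"
        using AB[OF \<alpha>] i by (auto simp: X(2)[OF \<alpha>] target_def)
      finally show ?thesis .
    qed (simp add: G_def x_def)
    then show ?thesis using x by blast
  qed
  have "bij_betw G (cube N) (cube N)"
    unfolding bij_betw_def using inj surj G_mem by (auto simp: image_iff)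
  with G_cont have "autohomeo N G" by (simp add: autohomeo_def)
  then show ?thesis using G by blast
qed

lemma card_of_finite_ordLess_infinite:
  "finite A \<Longrightarrow> infinite B \<Longrightarrow> |A| <o |B|"
  by (rule finite_ordLess_infinite) (simp_all add: Field_card_of card_of_well_order_on)

lemma card_of_UN_underS_finite:
  assumes r: "Card_order r" "infinite (Field r)" and \<alpha>: "\<alpha> \<in> Field r"
    and fin: "\<And>\<beta>. \<beta> \<in> underS r \<alpha> \<Longrightarrow> finite (B \<beta>)"
  shows "|\<Union>\<beta>\<in>underS r \<alpha>. B \<beta>| <o r"
proof (cases "finite (underS r \<alpha>)")
  case True
  then have "|\<Union>\<beta>\<in>underS r \<alpha>. B \<beta>| <o |Field r|"
    using fin r(2) by (intro card_of_finite_ordLess_infinite) auto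
  then show ?thesis
    using card_of_Field_ordIso[OF r(1)] ordLess_ordIso_trans by blast
next
  case False
  have "|\<Union>\<beta>\<in>underS r \<alpha>. B \<beta>| \<le>o |underS r \<alpha>|"
    using False fin
    by (intro card_of_UNION_ordLeq_infinite)
      (auto intro: card_of_mono1 ordLess_imp_ordLeq card_of_finite_ordLess_infinite)
  then show ?thesis
    using card_of_underS[OF r(1) \<alpha>] ordLeq_ordLess_trans by blast
qed

text \<open>
  This is the consequence of the Z-set condition on which the extension of homeomorphisms rests: over
  any set of fewer than \<open>\<tau>\<close> coordinates the identity can be replaced by a map whose image misses \<open>Z\<close>.
\<close>

definition avoidable :: "'i rel \<Rightarrow> ('i \<Rightarrow> real) set \<Rightarrow> bool" where
  "avoidable \<tau> Z \<longleftrightarrow> compact Z \<and> Z \<subseteq> cube (Field \<tau>) \<and>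
     (\<forall>A\<subseteq>Field \<tau>. |A| <o \<tau> \<longrightarrow>
       (\<exists>f. continuous_on (cube (Field \<tau>)) f \<and> (\<forall>x\<in>cube (Field \<tau>). f x \<in> cube (Field \<tau>) \<and>
         f x \<notin> Z \<and> (\<forall>i\<in>A. f x i = x i))))"

text \<open>
  At each stage of a recursion of length \<open>\<tau>\<close> the finite blocks chosen so far have fewer than \<open>\<tau>\<close>
  coordinates altogether, and so \<open>block_off_face\<close> yields a further block.  The product of all these
  block maps moves \<open>Z\<close> off \<open>\<tau>\<close> faces at once.
\<close>

lemma avoidable_off_faces:
  fixes \<tau> :: "'i rel"
  assumes \<tau>: "Card_order \<tau>" "infinite (Field \<tau>)" and Z: "avoidable \<tau> Z"
  shows "\<exists>G j. autohomeo (Field \<tau>) G \<and> inj_on j (Field \<tau>) \<and> j ` Field \<tau> \<subseteq> Field \<tau> \<and>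
    (\<forall>z\<in>Z. \<forall>\<alpha>\<in>Field \<tau>. G z (j \<alpha>) < 1)"
proof -
  define N where "N = Field \<tau>"
  have wo: "Well_order \<tau>" using \<tau>(1) card_order_on_well_order_on by blast
  have wf: "wf (\<tau> - Id)" using wo by (simp add: well_order_on_def)
  define good where "good = (\<lambda>A B j T. finite B \<and> B \<subseteq> N - A \<and> j \<in> B \<and> block_map N A B T \<and>
    (\<forall>z\<in>Z. T z j < (1::real)))"
  have step: "\<exists>B j T. good A B j T" if A: "A \<subseteq> N" "|A| <o \<tau>" for A
  proof -
    have zc: "compact Z" "Z \<subseteq> cube N" using Z by (auto simp: avoidable_def N_def)
    have inf: "infinite (N - A)"
    proof
      assume fin: "finite (N - A)"
      then have "|N - A| <o |Field \<tau>|"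
        using \<tau>(2) by (rule card_of_finite_ordLess_infinite)
      then have "|N - A| <o \<tau>"
        using card_of_Field_ordIso[OF \<tau>(1)] ordLess_ordIso_trans by blast
      then have "|A \<union> (N - A)| <o \<tau>"
        using card_of_Un_ordLess_infinite_Field[OF \<tau>(2,1) A(2)] by blast
      then have "|N| <o \<tau>" using A(1) by (simp add: Un_absorb1)
      then show False
        using card_of_Field_ordIso[OF \<tau>(1)] not_ordLess_ordIso by (auto simp: N_def)
    qed
    obtain f where f: "continuous_on (cube N) f"
      "\<forall>x\<in>cube N. f x \<in> cube N \<and> f x \<notin> Z \<and> (\<forall>i\<in>A. f x i = x i)"
      using Z A unfolding avoidable_def N_def by metis
    have f': "f x \<in> cube N" "i \<in> A \<Longrightarrow> f x i = x i" "f x \<notin> Z" if "x \<in> cube N" for x i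
      using bspec[OF f(2) that] by blast+
    show ?thesis
      unfolding good_def by (rule block_off_face[OF zc A(1) inf f(1) f'(1,2,3)])
  qed
  define P where "P = (\<lambda>(f :: 'i \<Rightarrow> 'i set \<times> 'i \<times> (('i \<Rightarrow> real) \<Rightarrow> 'i \<Rightarrow> real)) \<alpha> v. \<alpha> \<in> N \<longrightarrow>
    good (\<Union>\<beta>\<in>underS \<tau> \<alpha>. fst (f \<beta>)) (fst v) (fst (snd v)) (snd (snd v)))"
  have "\<exists>F. \<forall>\<alpha>. P F \<alpha> (F \<alpha>)"
  proof (rule dependent_wf_choice[OF wf, of P])
    fix f g :: "'i \<Rightarrow> 'i set \<times> 'i \<times> (('i \<Rightarrow> real) \<Rightarrow> 'i \<Rightarrow> real)" and \<alpha> v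
    assume eq: "\<And>z. (z, \<alpha>) \<in> \<tau> - Id \<Longrightarrow> f z = g z"
    have "fst (f \<beta>) = fst (g \<beta>)" if "\<beta> \<in> underS \<tau> \<alpha>" for \<beta>
      using eq[of \<beta>] that by (auto simp: underS_def)
    then have "(\<Union>\<beta>\<in>underS \<tau> \<alpha>. fst (f \<beta>)) = (\<Union>\<beta>\<in>underS \<tau> \<alpha>. fst (g \<beta>))"
      by (rule SUP_cong[OF refl])
    then show "P f \<alpha> v = P g \<alpha> v" by (simp add: P_def)
  next
    fix \<alpha> f
    assume IH: "\<And>\<beta>. (\<beta>, \<alpha>) \<in> \<tau> - Id \<Longrightarrow> P f \<beta> (f \<beta>)"
    show "\<exists>v. P f \<alpha> v"
    proof (cases "\<alpha> \<in> N")
      case True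
      have pre: "finite (fst (f \<beta>))" "fst (f \<beta>) \<subseteq> N" if "\<beta> \<in> underS \<tau> \<alpha>" for \<beta>
      proof -
        have "(\<beta>, \<alpha>) \<in> \<tau> - Id" "\<beta> \<in> N" using that by (auto simp: underS_def Field_def N_def)
        then show "finite (fst (f \<beta>))" "fst (f \<beta>) \<subseteq> N"
          using IH[of \<beta>] by (auto simp: P_def good_def)
      qed
      have "|\<Union>\<beta>\<in>underS \<tau> \<alpha>. fst (f \<beta>)| <o \<tau>"
        by (rule card_of_UN_underS_finite[OF \<tau>]) (use True pre in \<open>auto simp: N_def\<close>)
      moreover have "(\<Union>\<beta>\<in>underS \<tau> \<alpha>. fst (f \<beta>)) \<subseteq> N" using pre by blast
      ultimately obtain B j T where "good (\<Union>\<beta>\<in>underS \<tau> \<alpha>. fst (f \<beta>)) B j T"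
        using step by blast
      then show ?thesis by (intro exI[of _ "(B, j, T)"]) (simp add: P_def)
    qed (simp add: P_def)
  qed
  then obtain F where F: "\<And>\<alpha>. \<alpha> \<in> N \<Longrightarrow>
      good (\<Union>\<beta>\<in>underS \<tau> \<alpha>. fst (F \<beta>)) (fst (F \<alpha>)) (fst (snd (F \<alpha>))) (snd (snd (F \<alpha>)))"
    unfolding P_def by blast
  define B where "B = (\<lambda>\<alpha>. fst (F \<alpha>))"
  define j where "j = (\<lambda>\<alpha>. fst (snd (F \<alpha>)))"
  define T where "T = (\<lambda>\<alpha>. snd (snd (F \<alpha>)))"
  have g: "good (\<Union>\<beta>\<in>underS \<tau> \<alpha>. B \<beta>) (B \<alpha>) (j \<alpha>) (T \<alpha>)" if "\<alpha> \<in> Field \<tau>" for \<alpha>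
    using F that by (simp add: B_def j_def T_def N_def)
  have "\<exists>G. autohomeo N G \<and> (\<forall>x\<in>cube N. \<forall>\<alpha>\<in>Field \<tau>. \<forall>i\<in>B \<alpha>. G x i = T \<alpha> x i)"
    by (rule transfinite_block_product[OF wo]) (use g in \<open>auto simp: good_def\<close>)
  then obtain G where G: "autohomeo N G" "\<And>x \<alpha> i. x \<in> cube N \<Longrightarrow> \<alpha> \<in> N \<Longrightarrow> i \<in> B \<alpha> \<Longrightarrow> G x i = T \<alpha> x i"
    by (auto simp: N_def)
  have "inj_on j N"
  proof (rule inj_onI, rule ccontr)
    fix \<alpha> \<beta> assume ab: "\<alpha> \<in> N" "\<beta> \<in> N" "j \<alpha> = j \<beta>" "\<alpha> \<noteq> \<beta>"
    then have "\<alpha> \<in> underS \<tau> \<beta> \<or> \<beta> \<in> underS \<tau> \<alpha>"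
      using wo by (auto simp: underS_def well_order_on_def linear_order_on_def total_on_def N_def)
    moreover have "j \<alpha> \<in> B \<alpha>" "j \<beta> \<in> B \<beta>" using g ab(1,2) by (auto simp: good_def N_def)
    moreover have "B \<alpha> \<inter> (\<Union>\<beta>\<in>underS \<tau> \<alpha>. B \<beta>) = {}" "B \<beta> \<inter> (\<Union>\<alpha>\<in>underS \<tau> \<beta>. B \<alpha>) = {}"
      using g ab(1,2) by (auto simp: good_def N_def)
    ultimately show False using ab(3) by auto
  qed
  moreover have "j ` N \<subseteq> N" using g by (auto simp: good_def N_def)
  moreover have "G z (j \<alpha>) < 1" if "z \<in> Z" "\<alpha> \<in> N" for z \<alpha>
  proof -
    have zc: "z \<in> cube N" using Z that by (auto simp: avoidable_def N_def)
    have "j \<alpha> \<in> B \<alpha>" "T \<alpha> z (j \<alpha>) < 1" using g that by (auto simp: good_def N_def)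
    then show ?thesis using G(2)[OF zc that(2)] by simp
  qed
  ultimately show ?thesis using G(1) unfolding N_def by blast
qed

lemma recentre_below_zero:
  assumes Z: "compact Z" "Z \<subseteq> cube N" and J: "J \<subseteq> N" "\<And>z i. z \<in> Z \<Longrightarrow> i \<in> J \<Longrightarrow> z i < 1"
  shows "\<exists>G. autohomeo N G \<and> (\<forall>z\<in>Z. \<forall>i\<in>J. G z i < 0)"
proof -
  have "\<exists>u. \<bar>u\<bar> < 1 \<and> (\<forall>z\<in>Z. z i < u)" if i: "i \<in> J" for i
  proof (cases "Z = {}")
    case False
    obtain z where z: "z \<in> Z" "\<And>y. y \<in> Z \<Longrightarrow> y i \<le> z i"
      using continuous_attains_sup[OF Z(1) False continuous_on_projection[of Z i]] by blast
    have "- 1 \<le> z i" "z i < 1"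
      using cube_abs_le[of z N i] z(1) Z(2) J(2)[OF z(1) i] by auto
    moreover have "y i < (1 + z i) / 2" if "y \<in> Z" for y
      using z(2)[OF that] calculation by (simp add: field_simps)
    ultimately show ?thesis by (intro exI[of _ "(1 + z i) / 2"]) auto
  qed (auto intro: exI[of _ 0])
  then obtain u where u: "\<And>i. i \<in> J \<Longrightarrow> \<bar>u i\<bar> < (1::real)" "\<And>i z. i \<in> J \<Longrightarrow> z \<in> Z \<Longrightarrow> z i < u i"
    by metis
  have "shift_data N J (\<lambda>i x. - u i)"
    unfolding shift_data_def using J(1) u(1) by auto
  then have "autohomeo N (shift J (\<lambda>i x. - u i))" by (rule autohomeo_shift)
  moreover have "shift J (\<lambda>i x. - u i) z i < 0" if "z \<in> Z" "i \<in> J" for z i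
  proof -
    have "0 < 1 + z i * - u i"
      using vadd_denom_pos[of "z i" "- u i"] cube_abs_le[of z N i] u(1)[OF that(2)] that(1) Z(2) by auto
    moreover have "z i + - u i < 0" using u(2)[OF that(2,1)] by simp
    ultimately show ?thesis
      using that(2) unfolding shift_def vadd_def by (simp add: divide_neg_pos)
  qed
  ultimately show ?thesis by blast
qed

section \<open>Moving all coordinates into the open interval\<close>

text \<open>
  A homeomorphism \<open>f\<close> of the square is applied along a sequence: to the first two terms, then to the
  second component of the result and the third term, and so on.  The second components are the
  carries, and the first components form the image sequence.
\<close>

primrec carry :: "(real \<times> real \<Rightarrow> real \<times> real) \<Rightarrow> (nat \<Rightarrow> real) \<Rightarrow> nat \<Rightarrow> real" where
  "carry f x 0 = x 0"
| "carry f x (Suc n) = snd (f (carry f x n, x (Suc n)))"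

definition rolling :: "(real \<times> real \<Rightarrow> real \<times> real) \<Rightarrow> (nat \<Rightarrow> real) \<Rightarrow> nat \<Rightarrow> real" where
  "rolling f x n = fst (f (carry f x n, x (Suc n)))"

text \<open>
  The carries of the preimage of \<open>z\<close>, computed backwards from \<open>k\<close> places ahead, where the carry is
  taken to be \<open>0\<close>.
\<close>

primrec unroll :: "(real \<times> real \<Rightarrow> real \<times> real) \<Rightarrow> (nat \<Rightarrow> real) \<Rightarrow> nat \<Rightarrow> nat \<Rightarrow> real" where
  "unroll g z 0 = (\<lambda>n. 0)"
| "unroll g z (Suc k) = (\<lambda>n. fst (g (z n, unroll g z k (Suc n))))"

lemma square_iff: "(a, b) \<in> square \<longleftrightarrow> \<bar>a\<bar> \<le> 1 \<and> \<bar>b\<bar> \<le> 1"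
  by (auto simp: square_def abs_le_iff)

lemma square_fst_snd: "p \<in> square \<Longrightarrow> \<bar>fst p\<bar> \<le> 1 \<and> \<bar>snd p\<bar> \<le> 1"
  by (cases p) (simp add: square_iff)

lemma geometric_steps_converge:
  fixes u :: "nat \<Rightarrow> real"
  assumes "\<And>k. \<bar>u (Suc k) - u k\<bar> \<le> (1 / 2) ^ k"
  shows "convergent u"
proof -
  have "summable (\<lambda>k. u (Suc k) - u k)"
    by (rule summable_comparison_test'[OF summable_geometric[of "1 / 2 :: real"], of 0])
      (use assms in auto)
  then have "(\<lambda>m. \<Sum>k<m. u (Suc k) - u k) \<longlonglongrightarrow> (\<Sum>k. u (Suc k) - u k)"
    by (rule summable_LIMSEQ)
  then have "(\<lambda>m. u m - u 0) \<longlonglongrightarrow> (\<Sum>k. u (Suc k) - u k)"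
    by (simp only: sum_lessThan_telescope)
  then have "(\<lambda>m. (u m - u 0) + u 0) \<longlonglongrightarrow> (\<Sum>k. u (Suc k) - u k) + u 0"
    by (intro tendsto_add tendsto_const)
  then show ?thesis by (auto simp: convergent_def)
qed

lemma contraction_backwards_unique:
  fixes d :: "nat \<Rightarrow> real"
  assumes "\<And>n. d n \<le> d (Suc n) / 2" "\<And>n. d n \<le> 2"
  shows "d n \<le> 0"
proof -
  have "d n \<le> (1 / 2) ^ k * 2" for k n
  proof (induction k arbitrary: n)
    case (Suc k)
    have "d n \<le> d (Suc n) / 2" by (rule assms(1))
    also have "\<dots> \<le> ((1 / 2) ^ k * 2) / 2" by (rule divide_right_mono[OF Suc]) simp
    finally show ?case by simp
  qed (simp add: assms(2))
  moreover have "(\<lambda>k. (1 / 2) ^ k * 2 :: real) \<longlonglongrightarrow> 0 * 2"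
    by (intro tendsto_mult LIMSEQ_power_zero tendsto_const) simp
  ultimately show ?thesis
    using LIMSEQ_le_const[of "\<lambda>k. (1 / 2) ^ k * 2 :: real" "0 * 2" "d n"] by auto
qed

text \<open>
  Each term of the image depends on finitely many terms of the argument, which gives continuity.  In
  the opposite direction a carry is obtained from the next one by a map with Lipschitz constant one
  half.  Hence the carries are determined by the image sequence, and they exist as limits of the
  approximations \<open>unroll\<close>.
\<close>

lemma autohomeo_rolling:
  assumes f: "square_homeo f" and g: "square_homeo g"
    and gf: "\<And>p. p \<in> square \<Longrightarrow> g (f p) = p" and fg: "\<And>p. p \<in> square \<Longrightarrow> f (g p) = p"
    and contr: "\<And>z y x. \<bar>z\<bar> \<le> 1 \<Longrightarrow> \<bar>fst (g (z, y)) - fst (g (z, x))\<bar> \<le> \<bar>y - x\<bar> / 2"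
  shows "autohomeo UNIV (rolling f)"
proof -
  define C where "C = cube (UNIV :: nat set)"
  note f_mem = square_homeo_mem[OF f] and g_mem = square_homeo_mem[OF g]
  have x_le: "\<bar>x n\<bar> \<le> 1" if "x \<in> C" for x n
    using cube_abs_le that unfolding C_def .
  have carry_mem: "(carry f x n, x (Suc n)) \<in> square" if x: "x \<in> C" for x n
  proof (induction n)
    case 0
    then show ?case using x_le[OF x] by (simp add: square_iff)
  next
    case (Suc n)
    then show ?case using square_fst_snd[OF f_mem[OF Suc]] x_le[OF x] by (simp add: square_iff)
  qed
  have carry_le: "\<bar>carry f x n\<bar> \<le> 1" if "x \<in> C" for x n
    using carry_mem[OF that, of n] by (simp add: square_iff)
  have f_eq: "f (carry f x n, x (Suc n)) = (rolling f x n, carry f x (Suc n))" for x n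
    by (simp add: rolling_def)
  have g_eq: "g (rolling f x n, carry f x (Suc n)) = (carry f x n, x (Suc n))" if "x \<in> C" for x n
    using gf[OF carry_mem[OF that, of n]] by (simp only: f_eq)
  have roll_le: "\<bar>rolling f x n\<bar> \<le> 1" if "x \<in> C" for x n
    using square_fst_snd[OF f_mem[OF carry_mem[OF that, of n]]] by (simp add: rolling_def)
  have step_cont: "continuous_on C (\<lambda>x. f (carry f x n, x (Suc n)))"
    if "continuous_on C (\<lambda>x. carry f x n)" for n
  proof (rule continuous_on_compose2[of square f C "\<lambda>x. (carry f x n, x (Suc n))"])
    show "continuous_on square f" using f by (simp add: square_homeo_def)
    show "continuous_on C (\<lambda>x. (carry f x n, x (Suc n)))"
      by (rule continuous_on_Pair[OF that continuous_on_projection])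
    show "(\<lambda>x. (carry f x n, x (Suc n))) ` C \<subseteq> square"
      by (rule image_subsetI) (rule carry_mem)
  qed
  have carry_cont: "continuous_on C (\<lambda>x. carry f x n)" for n
  proof (induction n)
    case (Suc n)
    show ?case using continuous_on_snd[OF step_cont[OF Suc]] by simp
  qed (simp add: continuous_on_projection)
  have cont: "continuous_on C (rolling f)"
    by (rule continuous_on_coordinatewise_then_product)
      (unfold rolling_def, rule continuous_on_fst[OF step_cont[OF carry_cont]])
  have inj: "inj_on (rolling f) C"
  proof (rule inj_onI)
    fix x y assume x: "x \<in> C" and y: "y \<in> C" and eq: "rolling f x = rolling f y"
    define d where "d = (\<lambda>n. \<bar>carry f x n - carry f y n\<bar>)"
    have "d n \<le> d (Suc n) / 2" for n
    proof -
      have "carry f x n = fst (g (rolling f x n, carry f x (Suc n)))"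
        "carry f y n = fst (g (rolling f x n, carry f y (Suc n)))"
        using g_eq[OF x, of n] g_eq[OF y, of n] eq by simp_all
      then show ?thesis
        unfolding d_def using contr[OF roll_le[OF x, of n], of "carry f x (Suc n)" "carry f y (Suc n)"]
        by (simp only:)
    qed
    moreover have "d n \<le> 2" for n
      unfolding d_def using carry_le[OF x, of n] carry_le[OF y, of n] by linarith
    ultimately have "d n \<le> 0" for n by (rule contraction_backwards_unique)
    then have same: "carry f x n = carry f y n" for n
      by (simp add: d_def)
    show "x = y"
    proof
      fix n
      show "x n = y n"
      proof (cases n)
        case 0
        then show ?thesis using same[of 0] by simp
      next
        case (Suc m)
        have "g (rolling f y m, carry f y (Suc m)) = (carry f y m, x (Suc m))"
          using g_eq[OF x, of m] unfolding eq same .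
        then have "(carry f y m, x (Suc m)) = (carry f y m, y (Suc m))"
          using g_eq[OF y, of m] by (rule trans[OF sym])
        then show ?thesis using Suc by simp
      qed
    qed
  qed
  have surj: "\<exists>x\<in>C. rolling f x = z" if z: "z \<in> C" for z
  proof -
    have u_le: "\<bar>unroll g z k n\<bar> \<le> 1" for k n
    proof (induction k arbitrary: n)
      case (Suc k)
      have "(z n, unroll g z k (Suc n)) \<in> square" using x_le[OF z] Suc by (simp add: square_iff)
      then show ?case using square_fst_snd[OF g_mem] by simp
    qed simp
    have u_step: "\<bar>unroll g z (Suc k) n - unroll g z k n\<bar> \<le> (1 / 2) ^ k" for k n
    proof (induction k arbitrary: n)
      case 0
      show ?case using u_le[of "Suc 0" n] by simp
    next
      case (Suc k)
      have "\<bar>unroll g z (Suc (Suc k)) n - unroll g z (Suc k) n\<bar>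
          \<le> \<bar>unroll g z (Suc k) (Suc n) - unroll g z k (Suc n)\<bar> / 2"
        unfolding unroll.simps(2)[of g z "Suc k"] unroll.simps(2)[of g z k, THEN fun_cong, of n]
        by (rule contr[OF x_le[OF z]])
      also have "\<dots> \<le> (1 / 2) ^ k / 2" by (rule divide_right_mono[OF Suc]) simp
      finally show ?case by simp
    qed
    define l where "l = (\<lambda>n. lim (\<lambda>k. unroll g z k n))"
    have l: "(\<lambda>k. unroll g z k n) \<longlonglongrightarrow> l n" for n
      unfolding l_def by (rule convergent_LIMSEQ_iff[THEN iffD1, OF geometric_steps_converge[OF u_step]])
    have l_le: "\<bar>l n\<bar> \<le> 1" for n
      by (rule LIMSEQ_le_const2[OF tendsto_rabs[OF l]]) (use u_le in auto)
    have l_eq: "l n = fst (g (z n, l (Suc n)))" for n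
    proof -
      have "(\<lambda>k. \<bar>unroll g z k (Suc n) - l (Suc n)\<bar> / 2) \<longlonglongrightarrow> \<bar>l (Suc n) - l (Suc n)\<bar> / 2"
        by (intro tendsto_intros l) simp
      then have 0: "(\<lambda>k. \<bar>unroll g z k (Suc n) - l (Suc n)\<bar> / 2) \<longlonglongrightarrow> 0" by simp
      have "(\<lambda>k. unroll g z (Suc k) n - fst (g (z n, l (Suc n)))) \<longlonglongrightarrow> 0"
      proof (rule Lim_null_comparison[OF always_eventually 0], rule allI)
        show "norm (unroll g z (Suc k) n - fst (g (z n, l (Suc n))))
            \<le> \<bar>unroll g z k (Suc n) - l (Suc n)\<bar> / 2" for k
          unfolding unroll.simps real_norm_def by (rule contr[OF x_le[OF z]])
      qed
      then have "(\<lambda>k. unroll g z (Suc k) n) \<longlonglongrightarrow> fst (g (z n, l (Suc n)))"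
        by (rule LIM_zero_cancel)
      moreover have "(\<lambda>k. unroll g z (Suc k) n) \<longlonglongrightarrow> l n"
        by (rule LIMSEQ_Suc[OF l])
      ultimately show ?thesis by (rule LIMSEQ_unique[symmetric])
    qed
    define x where "x = (\<lambda>n. case n of 0 \<Rightarrow> l 0 | Suc m \<Rightarrow> snd (g (z m, l (Suc m))))"
    have zl: "(z n, l (Suc n)) \<in> square" for n using x_le[OF z] l_le by (simp add: square_iff)
    have "\<bar>x n\<bar> \<le> 1" for n
      using l_le square_fst_snd[OF g_mem[OF zl]] by (cases n) (simp_all add: x_def)
    then have x: "x \<in> C" by (auto simp: C_def cube_def)
    have step: "f (l n, x (Suc n)) = (z n, l (Suc n))" for n
    proof -
      have "(l n, x (Suc n)) = g (z n, l (Suc n))"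
        using l_eq[of n] by (simp add: x_def)
      then show ?thesis using fg[OF zl[of n]] by simp
    qed
    have c: "carry f x n = l n" for n
      by (induction n) (simp_all add: step, simp add: x_def)
    have "rolling f x = z"
      by (rule ext) (simp add: rolling_def c step)
    with x show ?thesis by blast
  qed
  have "rolling f ` C = C"
  proof
    show "rolling f ` C \<subseteq> C" using roll_le by (auto simp: C_def cube_def)
    show "C \<subseteq> rolling f ` C" using surj by blast
  qed
  then show ?thesis
    using cont inj unfolding autohomeo_def bij_betw_def C_def by blast
qed

text \<open>
  For the inverse of \<open>spread\<close> with \<open>c = 1 / 2\<close>, a point reaches one of the vertical sides only if it
  lies on the upper half of that side.  This is excluded as long as all entering terms are negative,
  whatever the carries are.  In particular the first term may take any value: an infinite stock of
  coordinates that avoid one end point makes up for a coordinate that does not.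
\<close>

lemma rolling_into_interior:
  obtains R where "autohomeo (UNIV :: nat set) R"
    "\<And>x n. x \<in> cube UNIV \<Longrightarrow> (\<And>m. x (Suc m) < 0) \<Longrightarrow> \<bar>R x n\<bar> < 1"
proof -
  define g where "g = spread (1 / 2)"
  have g: "square_homeo g" unfolding g_def by (rule square_homeo_spread) simp_all
  obtain f where f: "square_homeo f" "\<And>p. p \<in> square \<Longrightarrow> f (g p) = p" "\<And>p. p \<in> square \<Longrightarrow> g (f p) = p"
    by (rule square_homeo_inverse[OF g]) blast
  have R: "autohomeo UNIV (rolling f)"
    by (rule autohomeo_rolling[OF f(1) g f(3,2)]) (simp_all only: g_def spread_contraction)
  show thesis
  proof (rule that[OF R])
    fix x :: "nat \<Rightarrow> real" and n
    assume x: "x \<in> cube UNIV" and neg: "\<And>m. x (Suc m) < 0"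
    have in_sq: "(carry f x n, x (Suc n)) \<in> square" for n
    proof (induction n)
      case 0
      then show ?case using cube_abs_le[OF x] by (simp add: square_iff)
    next
      case (Suc n)
      then show ?case
        using square_fst_snd[OF square_homeo_mem[OF f(1) Suc]] cube_abs_le[OF x] by (simp add: square_iff)
    qed
    show "\<bar>rolling f x n\<bar> < 1"
    proof (rule ccontr)
      assume "\<not> ?thesis"
      moreover have le: "\<bar>rolling f x n\<bar> \<le> 1" "\<bar>carry f x (Suc n)\<bar> \<le> 1"
        using square_fst_snd[OF square_homeo_mem[OF f(1) in_sq[of n]]] by (simp_all add: rolling_def)
      ultimately have one: "\<bar>rolling f x n\<bar> = 1" by simp
      have "g (rolling f x n, carry f x (Suc n)) = (carry f x n, x (Suc n))"
        using f(3)[OF in_sq[of n]] by (simp add: rolling_def)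
      then have "x (Suc n) = (1 / 2) * (1 + carry f x (Suc n))"
        unfolding g_def spread_side[OF one] by simp
      moreover have "0 \<le> (1 / 2) * (1 + carry f x (Suc n))"
        using le(2) by (intro mult_nonneg_nonneg) auto
      ultimately show False using neg[of n] by (simp only: linorder_not_less[symmetric])
    qed
  qed
qed

text \<open>
  The cube is cut into sequences of coordinates by \<open>e\<close>, and \<open>R\<close> is applied to each of them.
\<close>

definition regroup ::
    "('k \<times> nat \<Rightarrow> 'i) \<Rightarrow> 'k set \<Rightarrow> 'i set \<Rightarrow> ((nat \<Rightarrow> real) \<Rightarrow> (nat \<Rightarrow> real)) \<Rightarrow> ('i \<Rightarrow> real) \<Rightarrow> ('i \<Rightarrow> real)" where
  "regroup e M N R x = (\<lambda>i. if i \<in> N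
     then R (\<lambda>k. x (e (fst (inv_into (M \<times> UNIV) e i), k))) (snd (inv_into (M \<times> UNIV) e i)) else 0)"

lemma autohomeo_regroup:
  assumes e: "bij_betw e (M \<times> UNIV) N" and R: "autohomeo UNIV R"
  shows "autohomeo N (regroup e M N R)"
    and "\<And>\<alpha> n. \<alpha> \<in> M \<Longrightarrow> regroup e M N R x (e (\<alpha>, n)) = R (\<lambda>k. x (e (\<alpha>, k))) n"
proof -
  have e_mem: "e (\<alpha>, n) \<in> N" if "\<alpha> \<in> M" for \<alpha> n
    using e that by (auto simp: bij_betw_def)
  have inv: "inv_into (M \<times> UNIV) e (e (\<alpha>, n)) = (\<alpha>, n)" if "\<alpha> \<in> M" for \<alpha> n
    using e that by (intro inv_into_f_f) (auto simp: bij_betw_def)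
  have cases: "\<exists>\<alpha>\<in>M. \<exists>n. i = e (\<alpha>, n)" if "i \<in> N" for i
    using e that by (auto simp: bij_betw_def)
  have val: "regroup e M N Q x (e (\<alpha>, n)) = Q (\<lambda>k. x (e (\<alpha>, k))) n" if "\<alpha> \<in> M" for Q x \<alpha> n
    using inv[OF that] e_mem[OF that] by (simp add: regroup_def)
  then show "\<And>\<alpha> n. \<alpha> \<in> M \<Longrightarrow> regroup e M N R x (e (\<alpha>, n)) = R (\<lambda>k. x (e (\<alpha>, k))) n" .
  have slice: "(\<lambda>k. x (e (\<alpha>, k))) \<in> cube UNIV" if "x \<in> cube N" for x \<alpha>
    using cube_abs_le[OF that] by (auto simp: cube_def)
  obtain Q where Q: "autohomeo UNIV Q" "\<And>x. x \<in> cube UNIV \<Longrightarrow> Q (R x) = x"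
    "\<And>x. x \<in> cube UNIV \<Longrightarrow> R (Q x) = x"
    by (rule autohomeo_inverse[OF R]) blast
  have mem: "regroup e M N P x \<in> cube N" if P: "autohomeo UNIV P" and x: "x \<in> cube N" for P x
  proof (rule cubeI)
    fix i assume "i \<in> N"
    then show "\<bar>regroup e M N P x i\<bar> \<le> 1"
      using cube_abs_le[OF autohomeo_mem[OF P slice[OF x]]] by (simp add: regroup_def)
  qed (simp add: regroup_def)
  have cancel: "regroup e M N P' (regroup e M N P x) = x"
    if "\<And>x. x \<in> cube UNIV \<Longrightarrow> P' (P x) = x" and x: "x \<in> cube N" for P P' x
  proof
    fix i
    show "regroup e M N P' (regroup e M N P x) i = x i"
    proof (cases "i \<in> N")
      case True
      then obtain \<alpha> n where \<alpha>: "\<alpha> \<in> M" "i = e (\<alpha>, n)" using cases by blast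
      have "(\<lambda>k. regroup e M N P x (e (\<alpha>, k))) = P (\<lambda>k. x (e (\<alpha>, k)))"
        by (rule ext) (rule val[OF \<alpha>(1)])
      then show ?thesis
        using that(1)[OF slice[OF x, of \<alpha>]] by (simp add: \<alpha>(2) val[OF \<alpha>(1)])
    next
      case False
      then show ?thesis using cube_off[OF x] by (simp add: regroup_def)
    qed
  qed
  have cont: "continuous_on (cube N) (regroup e M N R)"
  proof (rule continuous_on_coordinatewise_then_product)
    fix i
    show "continuous_on (cube N) (\<lambda>x. regroup e M N R x i)"
    proof (cases "i \<in> N")
      case True
      define \<alpha> where "\<alpha> = fst (inv_into (M \<times> UNIV) e i)"
      have "continuous_on (cube N) (\<lambda>x k. x (e (\<alpha>, k)))"
        by (rule continuous_on_coordinatewise_then_product) (rule continuous_on_projection)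
      then have "continuous_on (cube N) (\<lambda>x. R (\<lambda>k. x (e (\<alpha>, k))))"
        by (rule continuous_on_compose2[of "cube UNIV" R, rotated])
          (use R slice in \<open>auto simp: autohomeo_def\<close>)
      then show ?thesis
        using True continuous_on_coordinate[of "cube N" "\<lambda>x. R (\<lambda>k. x (e (\<alpha>, k)))"]
        by (simp add: regroup_def \<alpha>_def)
    qed (simp add: regroup_def)
  qed
  show "autohomeo N (regroup e M N R)"
    by (rule autohomeo_if_inverse[OF cont mem[OF R] mem[OF Q(1)]
        cancel[where P = R and P' = Q, OF Q(2)] cancel[where P = Q and P' = R, OF Q(3)]])
qed

lemma bij_betw_Times_nat:
  assumes "infinite N"
  obtains p where "bij_betw p (N \<times> (UNIV :: nat set)) N"
proof -
  have "|UNIV :: nat set| \<le>o |N|"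
    using assms by (simp add: infinite_iff_card_of_nat)
  then have "|N \<times> (UNIV :: nat set)| =o |N|"
    using card_of_Times_infinite[OF assms] by blast
  then show thesis
    using that by (auto simp flip: card_of_ordIso)
qed

text \<open>
  The index set is divided into sequences all of whose terms, apart from the first, belong to the
  image of \<open>j\<close>.  The first terms have to exhaust the other indices; some members of the image of \<open>j\<close>
  are left to them in order that they are as numerous as the sequences.
\<close>

lemma bij_betw_Times_nat_into:
  assumes N: "infinite N" and j: "inj_on j N" "j ` N \<subseteq> N"
  obtains e where "bij_betw e (N \<times> (UNIV :: nat set)) N"
    "\<And>\<alpha> n. \<alpha> \<in> N \<Longrightarrow> e (\<alpha>, Suc n) \<in> j ` N"
proof -
  obtain p where p: "bij_betw p (N \<times> (UNIV :: nat set)) N" by (rule bij_betw_Times_nat[OF N])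
  have p_mem: "p (\<alpha>, n) \<in> N" if "\<alpha> \<in> N" for \<alpha> n using p that by (auto simp: bij_betw_def)
  have p_inj: "\<alpha> = \<beta> \<and> m = n" if "\<alpha> \<in> N" "\<beta> \<in> N" "p (\<alpha>, m) = p (\<beta>, n)" for \<alpha> \<beta> m n
    using inj_onD[OF bij_betw_imp_inj_on[OF p] that(3)] that(1,2) by simp
  define q where "q = (\<lambda>a. j (p a))"
  have q_inj: "\<alpha> = \<beta> \<and> m = n" if "\<alpha> \<in> N" "\<beta> \<in> N" "q (\<alpha>, m) = q (\<beta>, n)" for \<alpha> \<beta> m n
    by (rule p_inj[OF that(1,2) inj_onD[OF j(1) that(3)[unfolded q_def] p_mem[OF that(1)] p_mem[OF that(2)]]])
  have q_mem: "q (\<alpha>, n) \<in> j ` N" if "\<alpha> \<in> N" for \<alpha> n using p_mem[OF that] by (simp add: q_def)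
  define Q where "Q = q ` (N \<times> range Suc)"
  have QN: "Q \<subseteq> N" using q_mem j(2) by (auto simp: Q_def)
  have "|N| \<le>o |N - Q|"
  proof (rule card_of_ordLeq[THEN iffD1], intro exI conjI)
    show "inj_on (\<lambda>\<alpha>. q (\<alpha>, 0::nat)) N" using q_inj by (auto intro: inj_onI)
    show "(\<lambda>\<alpha>. q (\<alpha>, 0::nat)) ` N \<subseteq> N - Q"
    proof (rule image_subsetI)
      fix \<alpha> assume \<alpha>: "\<alpha> \<in> N"
      have "q (\<alpha>, 0) \<notin> Q"
      proof
        assume "q (\<alpha>, 0) \<in> Q"
        then obtain \<beta> n where "\<beta> \<in> N" "q (\<alpha>, 0) = q (\<beta>, Suc n)" by (auto simp: Q_def)
        then show False using q_inj[OF \<alpha>, of \<beta> 0 "Suc n"] by simp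
      qed
      then show "q (\<alpha>, 0) \<in> N - Q" using q_mem[OF \<alpha>] j(2) by auto
    qed
  qed
  then have "|N| =o |N - Q|"
    using card_of_mono1[of "N - Q" N] by (simp add: ordIso_iff_ordLeq)
  then obtain t where t: "bij_betw t N (N - Q)" by (auto simp flip: card_of_ordIso)
  define e where "e = (\<lambda>(\<alpha>, n). case n of 0 \<Rightarrow> t \<alpha> | Suc m \<Rightarrow> q (\<alpha>, Suc m))"
  have e0: "e (\<alpha>, 0) = t \<alpha>" and eS: "e (\<alpha>, Suc m) = q (\<alpha>, Suc m)" for \<alpha> m
    by (simp_all add: e_def)
  have t_mem: "t \<alpha> \<in> N - Q" if "\<alpha> \<in> N" for \<alpha> using t that by (auto simp: bij_betw_def)
  have t_inj: "\<alpha> = \<beta>" if "\<alpha> \<in> N" "\<beta> \<in> N" "t \<alpha> = t \<beta>" for \<alpha> \<beta>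
    using inj_onD[OF bij_betw_imp_inj_on[OF t] that(3)] that(1,2) by simp
  have q_Q: "q (\<alpha>, Suc m) \<in> Q" if "\<alpha> \<in> N" for \<alpha> m using that by (auto simp: Q_def)
  have "inj_on e (N \<times> UNIV)"
  proof (rule inj_onI, clarify)
    fix \<alpha> \<beta> m n assume ab: "\<alpha> \<in> N" "\<beta> \<in> N" and eq: "e (\<alpha>, m) = e (\<beta>, n)"
    show "\<alpha> = \<beta> \<and> m = n"
    proof (cases m)
      case m: 0
      show ?thesis
      proof (cases n)
        case 0
        then show ?thesis using t_inj[OF ab] eq m by (simp add: e0)
      next
        case (Suc n')
        then show ?thesis using t_mem[OF ab(1)] q_Q[OF ab(2), of n'] eq m by (simp add: e0 eS)
      qed
    next
      case m: (Suc m')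
      show ?thesis
      proof (cases n)
        case 0
        then show ?thesis using t_mem[OF ab(2)] q_Q[OF ab(1), of m'] eq m by (simp add: e0 eS)
      next
        case (Suc n')
        then show ?thesis using q_inj[OF ab, of m n] eq m by (simp add: eS)
      qed
    qed
  qed
  moreover have "e ` (N \<times> UNIV) = N"
  proof
    show "e ` (N \<times> UNIV) \<subseteq> N"
    proof clarify
      fix \<alpha> and n :: nat assume "\<alpha> \<in> N"
      then show "e (\<alpha>, n) \<in> N" using t_mem q_Q QN by (cases n) (auto simp: e0 eS)
    qed
    show "N \<subseteq> e ` (N \<times> UNIV)"
    proof
      fix i assume i: "i \<in> N"
      show "i \<in> e ` (N \<times> UNIV)"
      proof (cases "i \<in> Q")
        case True
        then obtain \<alpha> n where "\<alpha> \<in> N" "i = q (\<alpha>, Suc n)" by (auto simp: Q_def)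
        then show ?thesis by (intro image_eqI[of _ _ "(\<alpha>, Suc n)"]) (simp_all add: eS)
      next
        case False
        then have "i \<in> t ` N" using t i by (auto simp: bij_betw_def)
        then obtain \<alpha> where "\<alpha> \<in> N" "i = t \<alpha>" by blast
        then show ?thesis by (intro image_eqI[of _ _ "(\<alpha>, 0)"]) (simp_all add: e0)
      qed
    qed
  qed
  ultimately have "bij_betw e (N \<times> UNIV) N" by (simp add: bij_betw_def)
  moreover have "e (\<alpha>, Suc n) \<in> j ` N" if "\<alpha> \<in> N" for \<alpha> n
    using q_mem[OF that] by (simp add: eS)
  ultimately show thesis by (rule that)
qed

lemma avoidable_into_interior:
  fixes \<tau> :: "'i rel"
  assumes \<tau>: "Card_order \<tau>" "infinite (Field \<tau>)" and Z: "avoidable \<tau> Z"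
  shows "\<exists>G. autohomeo (Field \<tau>) G \<and> (\<forall>z\<in>Z. \<forall>i. \<bar>G z i\<bar> < 1)"
proof -
  define N where "N = Field \<tau>"
  have zc: "compact Z" "Z \<subseteq> cube N" using Z by (auto simp: avoidable_def N_def)
  obtain G1 j where G1: "autohomeo N G1" and j: "inj_on j N" "j ` N \<subseteq> N"
    and less: "\<And>z \<alpha>. z \<in> Z \<Longrightarrow> \<alpha> \<in> N \<Longrightarrow> G1 z (j \<alpha>) < 1"
    using avoidable_off_faces[OF \<tau> Z] unfolding N_def by blast
  have "compact (G1 ` Z)"
    using G1 zc by (intro compact_continuous_image) (auto simp: autohomeo_def intro: continuous_on_subset)
  moreover have "G1 ` Z \<subseteq> cube N" using autohomeo_mem[OF G1] zc by blast
  ultimately have "\<exists>G. autohomeo N G \<and> (\<forall>z\<in>G1 ` Z. \<forall>i\<in>j ` N. G z i < 0)"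
    using j(2) less by (intro recentre_below_zero) auto
  then obtain G2 where G2: "autohomeo N G2" "\<And>z \<alpha>. z \<in> Z \<Longrightarrow> \<alpha> \<in> N \<Longrightarrow> G2 (G1 z) (j \<alpha>) < 0"
    by blast
  obtain e where e: "bij_betw e (N \<times> (UNIV :: nat set)) N" "\<And>\<alpha> n. \<alpha> \<in> N \<Longrightarrow> e (\<alpha>, Suc n) \<in> j ` N"
    using bij_betw_Times_nat_into[of N j] \<tau>(2) j unfolding N_def by blast
  obtain R where R: "autohomeo (UNIV :: nat set) R"
    "\<And>x n. x \<in> cube UNIV \<Longrightarrow> (\<And>m. x (Suc m) < 0) \<Longrightarrow> \<bar>R x n\<bar> < 1"
    by (rule rolling_into_interior) blast
  define G3 where "G3 = regroup e N N R"
  have G3: "autohomeo N G3" unfolding G3_def by (rule autohomeo_regroup(1)[OF e(1) R(1)])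
  have y: "G2 (G1 z) \<in> cube N" if "z \<in> Z" for z
    by (rule autohomeo_mem[OF G2(1) autohomeo_mem[OF G1]]) (use that zc in blast)
  have "\<bar>G3 (G2 (G1 z)) i\<bar> < 1" if z: "z \<in> Z" for z i
  proof (cases "i \<in> N")
    case True
    define y where "y = G2 (G1 z)"
    have y: "y \<in> cube N" unfolding y_def by (rule y[OF z])
    have "i \<in> e ` (N \<times> UNIV)" using True bij_betw_imp_surj_on[OF e(1)] by simp
    then obtain \<alpha> n where \<alpha>: "\<alpha> \<in> N" "i = e (\<alpha>, n)" by blast
    have "\<bar>R (\<lambda>k. y (e (\<alpha>, k))) n\<bar> < 1"
    proof (rule R(2))
      show "(\<lambda>k. y (e (\<alpha>, k))) \<in> cube UNIV" using cube_abs_le[OF y] by (auto simp: cube_def)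
      fix m
      obtain \<beta> where "\<beta> \<in> N" "e (\<alpha>, Suc m) = j \<beta>" using e(2)[OF \<alpha>(1), of m] by blast
      then show "y (e (\<alpha>, Suc m)) < 0" using G2(2)[OF z] by (simp add: y_def)
    qed
    then show ?thesis
      using autohomeo_regroup(2)[OF e(1) R(1) \<alpha>(1)] by (simp add: G3_def \<alpha>(2) y_def)
  next
    case False
    then show ?thesis using cube_off[OF autohomeo_mem[OF G3 y[OF z]] False] by simp
  qed
  moreover have "autohomeo N (\<lambda>x. G3 (G2 (G1 x)))"
    by (rule autohomeo_comp[OF autohomeo_comp[OF G1 G2(1)] G3])
  ultimately show ?thesis unfolding N_def by blast
qed

section \<open>Making half of the coordinates vanish\<close>

lemma tanh_artanh_real:
  fixes x :: real
  assumes "\<bar>x\<bar> < 1"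
  shows "tanh (artanh x) = x"
proof -
  define y where "y = (1 + x) / (1 - x)"
  have y: "0 < y" using assms by (auto simp: y_def abs_less_iff)
  have "artanh x = ln (sqrt y)"
    using y by (simp add: artanh_def y_def[symmetric] ln_sqrt)
  then have "tanh (artanh x) = (y - 1) / (y + 1)"
    using y by (simp add: tanh_ln_real)
  also have "\<dots> = x"
    using assms by (simp add: y_def field_simps abs_less_iff)
  finally show ?thesis .
qed

lemma vadd_tanh: "vadd (tanh a) (tanh b) = tanh (a + b :: real)"
  by (simp add: tanh_add vadd_def cosh_real_nonzero)

lemma vadd_tanh_same:
  assumes "\<bar>x\<bar> < 1" "\<bar>y\<bar> < 1" "vadd x (tanh a) = vadd y (tanh b)"
  shows "a - b = artanh y - artanh x"
proof -
  have "tanh (artanh x + a) = tanh (artanh y + b)"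
    using assms(3) by (simp add: vadd_tanh[symmetric] tanh_artanh_real[OF assms(1)] tanh_artanh_real[OF assms(2)])
  then have "artanh x + a = artanh y + b" by (simp only: tanh_real_eq_iff)
  then show ?thesis by simp
qed

lemma zero_if_le_all_inverse:
  fixes t :: real
  assumes "\<And>n::nat. \<bar>t\<bar> * real (Suc n) \<le> 2"
  shows "t = 0"
proof (rule ccontr)
  assume "t \<noteq> 0"
  then obtain n where "2 < real (Suc n) * \<bar>t\<bar>"
    using reals_Archimedean3[of "\<bar>t\<bar>"] by (metis abs_ge_zero less_le_trans mult_right_mono of_nat_mono le_Suc_eq order_refl zero_less_abs_iff)
  then show False using assms[of n] by (simp add: mult.commute)
qed

text \<open>
  Each coordinate in \<open>Y\<close> is added, with factors tending to infinity, to a sequence of coordinates in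
  \<open>X\<close>.  Addition here means \<open>vadd\<close> and takes place on the real line after applying \<open>artanh\<close>.  As the
  coordinates of \<open>Z\<close> stay in a compact part of the line, the quotients of the sums by the factors
  converge to the coordinate in \<open>Y\<close>, so that the coordinates in \<open>X\<close> now determine those in \<open>Y\<close>.
\<close>

lemma projection_injective_after_shear:
  assumes Z: "compact Z" "Z \<subseteq> cube N" "\<And>z i. z \<in> Z \<Longrightarrow> \<bar>z i\<bar> < 1"
    and XY: "N = X \<union> Y" "X \<inter> Y = {}"
    and q: "inj_on q (Y \<times> (UNIV :: nat set))" "q ` (Y \<times> UNIV) \<subseteq> X"
  shows "\<exists>G. autohomeo N G \<and> (\<forall>z\<in>Z. \<forall>i. \<bar>G z i\<bar> < 1) \<and>
    (\<forall>z\<in>Z. \<forall>w\<in>Z. (\<forall>i\<in>X. G z i = G w i) \<longrightarrow> G z = G w)"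
proof -
  have "\<exists>r. \<forall>z\<in>Z. \<bar>artanh (z i)\<bar> \<le> r" for i
  proof -
    have "continuous_on Z (\<lambda>z. artanh (z i))"
    proof (rule continuous_on_compose2[OF continuous_on_artanh[OF order_refl] continuous_on_projection])
      show "(\<lambda>z. z i) ` Z \<subseteq> {- 1<..<1}"
      proof (rule image_subsetI)
        show "z i \<in> {- 1<..<1}" if "z \<in> Z" for z
          using Z(3)[OF that, of i] unfolding abs_less_iff by auto
      qed
    qed
    then have "compact ((\<lambda>z. artanh (z i)) ` Z)" using Z(1) by (rule compact_continuous_image)
    then have "bounded ((\<lambda>z. artanh (z i)) ` Z)" by (rule compact_imp_bounded)
    then show ?thesis unfolding bounded_iff by auto
  qed
  then obtain r where r: "\<And>z i. z \<in> Z \<Longrightarrow> \<bar>artanh (z i)\<bar> \<le> r i" by metis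
  define W where "W = q ` (Y \<times> UNIV)"
  define y where "y = (\<lambda>i. fst (inv_into (Y \<times> UNIV) q i))"
  define n where "n = (\<lambda>i. snd (inv_into (Y \<times> UNIV) q i))"
  \<comment> \<open>As the factor dominates \<open>r i\<close>, points with the same sum in coordinate \<open>i\<close> differ by at most \<open>2 / Suc (n i)\<close> in coordinate \<open>y i\<close>.\<close>
  define M where "M = (\<lambda>i. real (Suc (n i)) * max 1 (r i))"
  have yn: "y (q (k, m)) = k" "n (q (k, m)) = m" if "k \<in> Y" for k m
    using inv_into_f_f[OF q(1), of "(k, m)"] that by (simp_all add: y_def n_def)
  have y_mem: "y i \<in> Y" if "i \<in> W" for i
    using that yn(1) by (auto simp: W_def)
  have W: "W \<subseteq> X" "W \<subseteq> N" using q(2) XY(1) by (auto simp: W_def)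
  define c where "c = (\<lambda>i x. tanh (M i * x (y i)) :: real)"
  have c_less: "\<bar>c i x\<bar> < 1" for i x
    using tanh_real_bounds[of "M i * x (y i)"] by (auto simp: c_def abs_less_iff)
  have sd: "shift_data N W c"
    unfolding shift_data_def
  proof (intro conjI ballI impI)
    show "W \<subseteq> N" by (rule W(2))
    show "continuous_on (cube N) (c i)" for i
      unfolding c_def by (intro continuous_on_tanh continuous_on_mult continuous_on_const continuous_on_projection)
        simp
    show "\<bar>c i x\<bar> < 1" for i x by (rule c_less)
    fix i and x x' :: "'a \<Rightarrow> real" assume "i \<in> W" "\<forall>k. k \<notin> W \<longrightarrow> x k = x' k"
    moreover have "y i \<notin> W" using y_mem[OF \<open>i \<in> W\<close>] W(1) XY(2) by blast
    ultimately show "c i x = c i x'" by (simp add: c_def)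
  qed
  define G where "G = shift W c"
  have G: "autohomeo N G" unfolding G_def by (rule autohomeo_shift[OF sd])
  have small: "\<bar>G z i\<bar> < 1" if "z \<in> Z" for z i
    using vadd_abs_less[OF Z(3)[OF that] c_less] Z(3)[OF that] by (simp add: G_def shift_def)
  have same: "G z = G w" if z: "z \<in> Z" and w: "w \<in> Z" and eq: "\<And>i. i \<in> X \<Longrightarrow> G z i = G w i" for z w
  proof
    fix i
    show "G z i = G w i"
    proof (cases "i \<in> Y")
      case True
      have "\<bar>z i - w i\<bar> * real (Suc m) \<le> 2" for m
      proof -
        define k where "k = q (i, m)"
        have k: "k \<in> W" "y k = i" "n k = m" using True yn by (auto simp: k_def W_def)
        have "G z k = G w k" using eq k(1) W(1) by blast
        then have "vadd (z k) (tanh (M k * z i)) = vadd (w k) (tanh (M k * w i))"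
          using k by (simp add: G_def shift_def c_def)
        then have "M k * z i - M k * w i = artanh (w k) - artanh (z k)"
          by (rule vadd_tanh_same[OF Z(3)[OF z] Z(3)[OF w]])
        then have "\<bar>M k * (z i - w i)\<bar> = \<bar>artanh (w k) - artanh (z k)\<bar>"
          by (simp add: algebra_simps)
        also have "\<dots> \<le> 2 * max 1 (r k)"
          using r[OF z, of k] r[OF w, of k] by linarith
        finally have "M k * \<bar>z i - w i\<bar> \<le> 2 * max 1 (r k)"
          by (simp add: abs_mult M_def)
        then have "(\<bar>z i - w i\<bar> * real (Suc m)) * max 1 (r k) \<le> 2 * max 1 (r k)"
          by (simp add: M_def k(3) mult_ac)
        then show ?thesis by (rule mult_right_le_imp_le) simp
      qed
      then have "z i - w i = 0" by (rule zero_if_le_all_inverse)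
      moreover have "i \<notin> W" using True W(1) XY(2) by blast
      ultimately show ?thesis by (simp add: G_def shift_def)
    next
      case False
      show ?thesis
      proof (cases "i \<in> X")
        case False
        then have "i \<notin> N" using \<open>i \<notin> Y\<close> XY(1) by blast
        then show ?thesis
          using cube_off[OF autohomeo_mem[OF G]] z w Z(2) by (metis subsetD)
      qed (rule eq)
    qed
  qed
  show ?thesis using G small same by blast
qed

lemma compact_autohomeo_image:
  assumes "autohomeo N G" "compact Z" "Z \<subseteq> cube N"
  shows "compact (G ` Z)" "G ` Z \<subseteq> cube N"
proof -
  have "continuous_on Z G"
    using assms unfolding autohomeo_def by (blast intro: continuous_on_subset)
  then show "compact (G ` Z)" using assms(2) by (rule compact_continuous_image)
  show "G ` Z \<subseteq> cube N" using autohomeo_mem[OF assms(1)] assms(3) by blast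
qed

lemma shift_data_trunc:
  assumes XY: "Y \<subseteq> N" "X \<inter> Y = {}"
    and g: "\<And>i. i \<in> Y \<Longrightarrow> continuous_on (cube N) (g i)"
      "\<And>i x. i \<in> Y \<Longrightarrow> x \<in> cube N \<Longrightarrow> \<bar>g i x\<bar> < (1::real)"
  shows "shift_data N Y (\<lambda>i x. g i (trunc X x))"
  unfolding shift_data_def
proof (intro conjI ballI impI)
  show "Y \<subseteq> N" by (rule XY(1))
  fix i assume i: "i \<in> Y"
  show "continuous_on (cube N) (\<lambda>x. g i (trunc X x))"
    by (rule continuous_on_compose2[OF g(1)[OF i] continuous_on_trunc]) (auto simp: trunc_mem)
  show "\<bar>g i (trunc X x)\<bar> < 1" if "x \<in> cube N" for x
    by (rule g(2)[OF i trunc_mem[OF that]])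
  fix x y assume "\<forall>k. k \<notin> Y \<longrightarrow> x k = (y k :: real)"
  then have "trunc X x = trunc X y" using XY(2) by (auto simp: trunc_def fun_eq_iff)
  then show "g i (trunc X x) = g i (trunc X y)" by simp
qed

text \<open>
  If the coordinates in \<open>X\<close> determine the points of \<open>K\<close>, then \<open>K\<close> is part of the graph of a continuous
  function of these coordinates.  By Tietze's theorem this function extends to the cube, and
  shifting by its negative flattens the graph.
\<close>

lemma flatten_graph:
  assumes K: "compact K" "K \<subseteq> cube N" "\<And>k i. k \<in> K \<Longrightarrow> \<bar>k i\<bar> < 1"
    and XY: "N = X \<union> Y" "X \<inter> Y = {}"
    and inj: "\<And>k l. k \<in> K \<Longrightarrow> l \<in> K \<Longrightarrow> (\<And>i. i \<in> X \<Longrightarrow> k i = l i) \<Longrightarrow> k = l"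
  shows "\<exists>G. autohomeo N G \<and> (\<forall>k\<in>K. (\<forall>i\<in>Y. G k i = 0) \<and> (\<forall>i. \<bar>G k i\<bar> < 1))"
proof -
  have inj': "inj_on (trunc X) K"
  proof (rule inj_onI)
    fix k l assume "k \<in> K" "l \<in> K" "trunc X k = trunc X l"
    then show "k = l" by (intro inj) (auto simp: trunc_def fun_eq_iff split: if_splits)
  qed
  define K' where "K' = trunc X ` K"
  define s where "s = inv_into K (trunc X)"
  have s: "continuous_on K' s"
    unfolding K'_def s_def by (rule continuous_on_compact_inverse[OF K(1) continuous_on_trunc inj'])
  have s_eq: "s (trunc X k) = k" if "k \<in> K" for k
    unfolding s_def by (rule inv_into_f_f[OF inj' that])
  have K': "compact K'" "K' \<subseteq> cube N"
    unfolding K'_def using K(1,2) trunc_mem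
    by (auto intro!: compact_continuous_image continuous_on_trunc)
  have "\<exists>g. continuous_on (cube N) g \<and> (\<forall>x\<in>K'. g x = - s x i) \<and> (\<forall>x\<in>cube N. \<bar>g x\<bar> < 1)" for i
  proof -
    have c: "continuous_on K' (\<lambda>x. - s x i)"
      by (rule continuous_on_minus[OF continuous_on_coordinate[OF s]])
    have l: "\<bar>- s x i\<bar> < 1" if "x \<in> K'" for x
      using that s_eq K(3) by (auto simp: K'_def)
    show ?thesis using extend_function_from_compact[OF K' c l] by metis
  qed
  then obtain g where g: "\<And>i. continuous_on (cube N) (g i)" "\<And>i x. x \<in> K' \<Longrightarrow> g i x = - s x i"
    "\<And>i x. x \<in> cube N \<Longrightarrow> \<bar>g i x\<bar> < 1" by metis
  define G where "G = shift Y (\<lambda>i x. g i (trunc X x))"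
  have G: "autohomeo N G"
    unfolding G_def by (rule autohomeo_shift[OF shift_data_trunc]) (use XY g in auto)
  have "G k i = (if i \<in> Y then 0 else k i)" if "k \<in> K" for k i
  proof -
    have "trunc X k \<in> K'" using that by (simp add: K'_def)
    then show ?thesis by (simp add: G_def shift_def g(2) s_eq[OF that])
  qed
  then show ?thesis using G K(3) by (intro exI[of _ G]) auto
qed

lemma interior_into_deficient:
  assumes Z: "compact Z" "Z \<subseteq> cube N" "\<And>z i. z \<in> Z \<Longrightarrow> \<bar>z i\<bar> < 1"
    and XY: "N = X \<union> Y" "X \<inter> Y = {}"
    and q: "inj_on q (Y \<times> (UNIV :: nat set))" "q ` (Y \<times> UNIV) \<subseteq> X"
  shows "\<exists>G. autohomeo N G \<and> (\<forall>z\<in>Z. (\<forall>i\<in>Y. G z i = 0) \<and> (\<forall>i. \<bar>G z i\<bar> < 1))"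
proof -
  have "\<exists>S. autohomeo N S \<and> (\<forall>z\<in>Z. \<forall>i. \<bar>S z i\<bar> < 1) \<and>
      (\<forall>z\<in>Z. \<forall>w\<in>Z. (\<forall>i\<in>X. S z i = S w i) \<longrightarrow> S z = S w)"
    by (rule projection_injective_after_shear[OF Z(1,2) _ XY q]) (rule Z(3))
  then obtain S where S: "autohomeo N S" "\<And>z i. z \<in> Z \<Longrightarrow> \<bar>S z i\<bar> < 1"
    "\<And>z w. z \<in> Z \<Longrightarrow> w \<in> Z \<Longrightarrow> (\<And>i. i \<in> X \<Longrightarrow> S z i = S w i) \<Longrightarrow> S z = S w"
    by blast
  have "\<exists>G. autohomeo N G \<and> (\<forall>k\<in>S ` Z. (\<forall>i\<in>Y. G k i = 0) \<and> (\<forall>i. \<bar>G k i\<bar> < 1))"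
    by (rule flatten_graph[OF compact_autohomeo_image[OF S(1) Z(1,2)] _ XY]) (use S(2,3) in auto)
  then obtain G where G: "autohomeo N G"
    "\<And>z. z \<in> Z \<Longrightarrow> (\<forall>i\<in>Y. G (S z) i = 0) \<and> (\<forall>i. \<bar>G (S z) i\<bar> < 1)" by blast
  then show ?thesis using autohomeo_comp[OF S(1) G(1)] by blast
qed

section \<open>Extending homeomorphisms\<close>

text \<open>
  Klee's trick: \<open>K\<close> lies in the \<open>X\<close>-factor and its image in the \<open>Y\<close>-factor.  A shift of the
  coordinates in \<open>Y\<close> by an extension of \<open>h\<close> moves \<open>K\<close> to the graph of \<open>h\<close>, and a shift of the
  coordinates in \<open>X\<close> by an extension of the inverse of \<open>h\<close> moves this graph to the image of \<open>h\<close>.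
\<close>

lemma graph_trick:
  assumes K: "compact K" "K \<subseteq> cube N" "\<And>k i. k \<in> K \<Longrightarrow> \<bar>k i\<bar> < 1" "\<And>k i. k \<in> K \<Longrightarrow> i \<in> Y \<Longrightarrow> k i = 0"
    and h: "continuous_on K h" "inj_on h K" "h ` K \<subseteq> cube N"
      "\<And>k i. k \<in> K \<Longrightarrow> \<bar>h k i\<bar> < 1" "\<And>k i. k \<in> K \<Longrightarrow> i \<in> X \<Longrightarrow> h k i = 0"
    and XY: "N = X \<union> Y" "X \<inter> Y = {}"
  shows "\<exists>H. autohomeo N H \<and> (\<forall>k\<in>K. H k = h k)"
proof -
  define h' where "h' = inv_into K h"
  have h'_eq: "h' (h k) = k" if "k \<in> K" for k
    unfolding h'_def by (rule inv_into_f_f[OF h(2) that])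
  have h'_cont: "continuous_on (h ` K) h'"
    unfolding h'_def by (rule continuous_on_compact_inverse[OF K(1) h(1,2)])
  have hK: "compact (h ` K)" using h(1) K(1) by (rule compact_continuous_image)
  have "\<exists>g. continuous_on (cube N) g \<and> (\<forall>k\<in>K. g k = h k i) \<and> (\<forall>x\<in>cube N. \<bar>g x\<bar> < 1)" for i
    using extend_function_from_compact[OF K(1,2) continuous_on_coordinate[OF h(1)] h(4)] by metis
  then obtain g where g: "\<And>i. continuous_on (cube N) (g i)" "\<And>i k. k \<in> K \<Longrightarrow> g i k = h k i"
    "\<And>i x. x \<in> cube N \<Longrightarrow> \<bar>g i x\<bar> < 1" by metis
  have "\<exists>p. continuous_on (cube N) p \<and> (\<forall>y\<in>h ` K. p y = - h' y i) \<and> (\<forall>x\<in>cube N. \<bar>p x\<bar> < 1)" for i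
  proof -
    have c: "continuous_on (h ` K) (\<lambda>y. - h' y i)"
      by (rule continuous_on_minus[OF continuous_on_coordinate[OF h'_cont]])
    have l: "\<bar>- h' y i\<bar> < 1" if "y \<in> h ` K" for y
      using that h'_eq K(3) by auto
    show ?thesis using extend_function_from_compact[OF hK h(3) c l] by metis
  qed
  then obtain p where p: "\<And>i. continuous_on (cube N) (p i)" "\<And>i y. y \<in> h ` K \<Longrightarrow> p i y = - h' y i"
    "\<And>i x. x \<in> cube N \<Longrightarrow> \<bar>p i x\<bar> < 1" by metis
  \<comment> \<open>The truncations make the amounts depend on the coordinates in \<open>X\<close>, respectively \<open>Y\<close>, only.\<close>
  define S where "S = shift Y (\<lambda>i x. g i (trunc X x))"
  define T where "T = shift X (\<lambda>i x. p i (trunc Y x))"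
  have S: "autohomeo N S"
    unfolding S_def by (rule autohomeo_shift[OF shift_data_trunc]) (use XY g in auto)
  have T: "autohomeo N T"
    unfolding T_def by (rule autohomeo_shift[OF shift_data_trunc]) (use XY p in auto)
  have "T (S k) = h k" if k: "k \<in> K" for k
  proof -
    have kN: "k \<in> cube N" and hN: "h k \<in> cube N" using k K(2) h(3) by auto
    have tk: "trunc X k = k"
      using K(4)[OF k] cube_off[OF kN] XY(1) by (auto simp: trunc_def fun_eq_iff)
    have Sk: "S k = (\<lambda>i. if i \<in> Y then h k i else k i)"
      by (rule ext) (simp add: S_def shift_def tk g(2)[OF k] K(4)[OF k])
    have "trunc Y (S k) i = h k i" for i
      using h(5)[OF k, of i] cube_off[OF hN, of i] XY(1) by (auto simp: trunc_def Sk)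
    then have ty: "trunc Y (S k) = h k" by (rule ext)
    have pk: "p i (h k) = - k i" for i
      using p(2)[of "h k" i] k by (simp add: h'_eq)
    show ?thesis
    proof
      fix i
      consider "i \<in> X" "i \<notin> Y" | "i \<in> Y" "i \<notin> X" | "i \<notin> X" "i \<notin> Y" using XY(2) by blast
      then show "T (S k) i = h k i"
      proof cases
        case 1
        then show ?thesis using h(5)[OF k 1(1)] by (simp add: T_def shift_def ty pk) (simp add: Sk)
      next
        case 2
        then show ?thesis by (simp add: T_def shift_def) (simp add: Sk)
      next
        case 3
        then have "i \<notin> N" using XY(1) by blast
        then show ?thesis using 3 cube_off[OF kN] cube_off[OF hN] by (simp add: T_def shift_def Sk)
      qed
    qed
  qed
  then show ?thesis using autohomeo_comp[OF S T] by blast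
qed

text \<open>
  Both halves have the cardinality of \<open>N\<close>, and each contains countably many indices for every index
  in the other one.  So the two sets in \<open>graph_trick\<close> can be brought into complementary factors.
\<close>

lemma halving_partition:
  assumes "infinite (N :: 'i set)"
  obtains X Y and q q' :: "'i \<times> nat \<Rightarrow> 'i" where "N = X \<union> Y" "X \<inter> Y = {}"
    "inj_on q (Y \<times> UNIV)" "q ` (Y \<times> UNIV) \<subseteq> X" "inj_on q' (X \<times> UNIV)" "q' ` (X \<times> UNIV) \<subseteq> Y"
proof -
  obtain p where p: "bij_betw p (N \<times> (UNIV :: nat set)) N" by (rule bij_betw_Times_nat[OF assms])
  have p_mem: "p (\<alpha>, n) \<in> N" if "\<alpha> \<in> N" for \<alpha> n
    using bij_betw_imp_surj_on[OF p] that by blast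
  have p_inj: "\<alpha> = \<beta> \<and> m = n" if "p (\<alpha>, m) = p (\<beta>, n)" "\<alpha> \<in> N" "\<beta> \<in> N" for \<alpha> \<beta> m n
    using inj_onD[OF bij_betw_imp_inj_on[OF p] that(1)] that(2,3) by simp
  define Y where "Y = p ` (N \<times> {0})"
  define X where "X = N - Y"
  have YN: "Y \<subseteq> N" using p_mem by (auto simp: Y_def)
  have inj: "inj_on (\<lambda>a. p (p a, m)) (M \<times> UNIV)" if "M \<subseteq> N" for m M
  proof (rule inj_onI, clarify)
    fix a b and k l :: nat assume ab: "a \<in> M" "b \<in> M" and eq: "p (p (a, k), m) = p (p (b, l), m)"
    have abN: "a \<in> N" "b \<in> N" using ab that by auto
    have "p (a, k) = p (b, l)" using p_inj[OF eq p_mem[OF abN(1)] p_mem[OF abN(2)]] by blast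
    then show "a = b \<and> k = l" using p_inj abN by blast
  qed
  show thesis
  \<comment> \<open>The inner \<open>p\<close> makes a sequence for each index, and the second argument of the outer one selects the half.\<close>
  proof (rule that[of X Y "\<lambda>a. p (p a, 1)" "\<lambda>a. p (p a, 0)"])
    show "N = X \<union> Y" "X \<inter> Y = {}" using YN by (auto simp: X_def)
    show "inj_on (\<lambda>a. p (p a, 1)) (Y \<times> UNIV)" by (rule inj[OF YN])
    show "inj_on (\<lambda>a. p (p a, 0)) (X \<times> UNIV)" by (rule inj) (auto simp: X_def)
    show "(\<lambda>a. p (p a, 0)) ` (X \<times> UNIV) \<subseteq> Y"
      using p_mem by (auto simp: X_def Y_def)
    show "(\<lambda>a. p (p a, 1)) ` (Y \<times> UNIV) \<subseteq> X"
    proof clarify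
      fix a and k :: nat assume "a \<in> Y"
      then have a: "p (a, k) \<in> N" using YN p_mem by blast
      have "p (p (a, k), 1) \<notin> Y"
      proof
        assume "p (p (a, k), 1) \<in> Y"
        then obtain \<beta> where "\<beta> \<in> N" "p (p (a, k), 1) = p (\<beta>, 0)" by (auto simp: Y_def)
        then show False using p_inj[of "p (a, k)" 1 \<beta> 0] a by simp
      qed
      then show "p (p (a, k), 1) \<in> X" using p_mem[OF a] by (simp add: X_def)
    qed
  qed
qed

text \<open>
  The domain is moved into the \<open>X\<close>-factor and the image into the \<open>Y\<close>-factor, after which
  \<open>graph_trick\<close> applies.
\<close>

theorem avoidable_homeo_extends:
  fixes \<tau> :: "'i rel"
  assumes \<tau>: "Card_order \<tau>" "infinite (Field \<tau>)" and Z: "avoidable \<tau> Z" and F: "avoidable \<tau> F"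
    and h: "continuous_on Z h" "bij_betw h Z F"
  shows "\<exists>H. autohomeo (Field \<tau>) H \<and> (\<forall>z\<in>Z. H z = h z)"
proof -
  define N where "N = Field \<tau>"
  have zc: "compact Z" "Z \<subseteq> cube N" and fc: "compact F" "F \<subseteq> cube N"
    using Z F by (auto simp: avoidable_def N_def)
  obtain X Y and q q' :: "'i \<times> nat \<Rightarrow> 'i" where XY: "N = X \<union> Y" "X \<inter> Y = {}"
    and q: "inj_on q (Y \<times> UNIV)" "q ` (Y \<times> UNIV) \<subseteq> X"
    and q': "inj_on q' (X \<times> UNIV)" "q' ` (X \<times> UNIV) \<subseteq> Y"
    using halving_partition[of N] \<tau>(2) unfolding N_def by metis
  have normal: "\<exists>G. autohomeo N G \<and> (\<forall>z\<in>C. (\<forall>i\<in>B. G z i = 0) \<and> (\<forall>i. \<bar>G z i\<bar> < 1))"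
    if C: "avoidable \<tau> C" and AB: "N = A \<union> B" "A \<inter> B = {}"
      and r: "inj_on r (B \<times> (UNIV :: nat set))" "r ` (B \<times> UNIV) \<subseteq> A" for C A B r
  proof -
    obtain G where G: "autohomeo N G" "\<And>z i. z \<in> C \<Longrightarrow> \<bar>G z i\<bar> < 1"
      using avoidable_into_interior[OF \<tau> C] unfolding N_def by blast
    have "compact C" "C \<subseteq> cube N" using C by (auto simp: avoidable_def N_def)
    note im = compact_autohomeo_image[OF G(1) this]
    have "\<exists>G'. autohomeo N G' \<and> (\<forall>z\<in>G ` C. (\<forall>i\<in>B. G' z i = 0) \<and> (\<forall>i. \<bar>G' z i\<bar> < 1))"
      by (rule interior_into_deficient[OF im _ AB r]) (use G(2) in blast)
    then obtain G' where G': "autohomeo N G'"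
      "\<And>z. z \<in> C \<Longrightarrow> (\<forall>i\<in>B. G' (G z) i = 0) \<and> (\<forall>i. \<bar>G' (G z) i\<bar> < 1)" by blast
    then show ?thesis using autohomeo_comp[OF G(1) G'(1)] by blast
  qed
  obtain P where P: "autohomeo N P" "\<And>z i. z \<in> Z \<Longrightarrow> i \<in> Y \<Longrightarrow> P z i = 0" "\<And>z i. z \<in> Z \<Longrightarrow> \<bar>P z i\<bar> < 1"
    using normal[OF Z XY q] by blast
  have YX: "N = Y \<union> X" "Y \<inter> X = {}" using XY by auto
  obtain Q where Q: "autohomeo N Q" "\<And>z i. z \<in> F \<Longrightarrow> i \<in> X \<Longrightarrow> Q z i = 0" "\<And>z i. z \<in> F \<Longrightarrow> \<bar>Q z i\<bar> < 1"
    using normal[OF F YX q'] by blast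
  obtain P' where P': "autohomeo N P'" "\<And>x. x \<in> cube N \<Longrightarrow> P' (P x) = x"
    by (rule autohomeo_inverse[OF P(1)]) blast
  obtain Q' where Q': "autohomeo N Q'" "\<And>x. x \<in> cube N \<Longrightarrow> Q' (Q x) = x"
    by (rule autohomeo_inverse[OF Q(1)]) blast
  have P'P: "P' (P z) = z" if "z \<in> Z" for z using P'(2) that zc(2) by blast
  have hF: "h z \<in> F" if "z \<in> Z" for z using h(2) that by (auto simp: bij_betw_def)
  define k where "k = (\<lambda>x. Q (h (P' x)))"
  have k_eq: "k (P z) = Q (h z)" if "z \<in> Z" for z by (simp add: k_def P'P[OF that])
  note PZ = compact_autohomeo_image[OF P(1) zc]
  have "\<exists>H. autohomeo N H \<and> (\<forall>x\<in>P ` Z. H x = k x)"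
  proof (rule graph_trick[OF PZ _ _ _ _ _ _ _ XY])
    show "continuous_on (P ` Z) k"
    proof -
      have 1: "continuous_on (P ` Z) P'"
        using P'(1) PZ(2) unfolding autohomeo_def by (blast intro: continuous_on_subset)
      have 2: "continuous_on (P ` Z) (\<lambda>x. h (P' x))"
        by (rule continuous_on_compose2[OF h(1) 1]) (use P'P in auto)
      have "continuous_on (cube N) Q" using Q(1) by (simp add: autohomeo_def)
      then show ?thesis
        unfolding k_def by (rule continuous_on_compose2[OF _ 2]) (use P'P hF fc(2) in auto)
    qed
    show "inj_on k (P ` Z)"
    proof (rule inj_onI, clarify)
      fix z w assume zw: "z \<in> Z" "w \<in> Z" and "k (P z) = k (P w)"
      then have "Q (h z) = Q (h w)" by (simp add: k_eq)
      then have "h z = h w" using autohomeo_inj[OF Q(1)] hF zw fc(2) by blast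
      then have "z = w" using h(2) zw by (auto simp: bij_betw_def inj_on_def)
      then show "P z = P w" by simp
    qed
    show "k ` P ` Z \<subseteq> cube N"
      using autohomeo_mem[OF Q(1) subsetD[OF fc(2) hF]] by (auto simp: k_eq)
  qed (use P(2,3) Q(2,3) hF in \<open>auto simp: k_eq\<close>)
  then obtain H where H: "autohomeo N H" "\<And>z. z \<in> Z \<Longrightarrow> H (P z) = Q (h z)"
    using k_eq by (metis imageI)
  have "autohomeo N (\<lambda>x. Q' (H (P x)))"
    by (rule autohomeo_comp[OF autohomeo_comp[OF P(1) H(1)] Q'(1)])
  moreover have "Q' (H (P z)) = h z" if "z \<in> Z" for z
    using H(2)[OF that] Q'(2) hF[OF that] fc(2) by auto
  ultimately show ?thesis unfolding N_def by blast
qed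

section \<open>Z-sets in the Tychonoff cube\<close>

lemma card_of_Times_nat_ordLess:
  assumes \<tau>: "natLeq <o \<tau>" and A: "|A| <o \<tau>"
  shows "|A \<times> (UNIV :: nat set)| <o \<tau>"
proof (cases "finite A")
  case True
  then have "countable (A \<times> (UNIV :: nat set))" by (simp add: countable_finite)
  then obtain f :: "_ \<Rightarrow> nat" where "inj_on f (A \<times> (UNIV :: nat set))" by (rule countableE)
  then have "|A \<times> (UNIV :: nat set)| \<le>o |UNIV :: nat set|"
    by (intro card_of_ordLeq[THEN iffD1]) auto
  then have "|A \<times> (UNIV :: nat set)| \<le>o natLeq"
    using card_of_nat ordLeq_ordIso_trans by blast
  then show ?thesis using \<tau> by (rule ordLeq_ordLess_trans)
next
  case False
  then have "|UNIV :: nat set| \<le>o |A|" by (simp add: infinite_iff_card_of_nat)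
  then have "|A \<times> (UNIV :: nat set)| =o |A|"
    using card_of_Times_infinite[OF False] by blast
  then show ?thesis using A by (rule ordIso_ordLess_trans)
qed

lemma topspace_tychonoff_cube: "topspace (tychonoff_cube \<tau>) = PiE (Field \<tau>) (\<lambda>i. {0..1})"
  by (simp add: tychonoff_cube_def)

lemma continuous_map_cube_coordinate:
  assumes "i \<in> Field \<tau>"
  shows "continuous_map (tychonoff_cube \<tau>) euclideanreal (\<lambda>x. x i)"
proof (rule continuous_map_into_fulltopology)
  show "continuous_map (tychonoff_cube \<tau>) (top_of_set {0..1}) (\<lambda>x. x i)"
    unfolding tychonoff_cube_def by (rule continuous_map_product_projection[OF assms])
qed

text \<open>
  Two maps that are close for all covers of this kind agree in the coordinate \<open>a\<close>: the radii tend to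
  \<open>0\<close>, while rational centres make each of the covers countable.
\<close>

definition coordinate_cover :: "'i rel \<Rightarrow> 'i \<Rightarrow> nat \<Rightarrow> ('i \<Rightarrow> real) set set" where
  "coordinate_cover \<tau> a n =
     (\<lambda>q. {x \<in> topspace (tychonoff_cube \<tau>). \<bar>x a - q\<bar> < 1 / real (Suc n)}) ` \<rat>"

lemma coordinate_cover_in_cov:
  assumes "a \<in> Field \<tau>"
  shows "coordinate_cover \<tau> a n \<in> cov (tychonoff_cube \<tau>)"
  unfolding cov_def
proof (intro CollectI conjI ballI)
  let ?X = "tychonoff_cube \<tau>"
  show "countable (coordinate_cover \<tau> a n)"
    unfolding coordinate_cover_def by (intro countable_image countable_rat)
  show "functionally_open ?X U" if "U \<in> coordinate_cover \<tau> a n" for U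
  proof -
    obtain q where U: "U = {x \<in> topspace ?X. \<bar>x a - q\<bar> < 1 / real (Suc n)}"
      using \<open>U \<in> coordinate_cover \<tau> a n\<close> by (auto simp: coordinate_cover_def)
    define \<phi> where "\<phi> = (\<lambda>t::real. max 0 (1 / real (Suc n) - \<bar>t - q\<bar>))"
    have "continuous_on UNIV \<phi>" unfolding \<phi>_def by (intro continuous_intros)
    then have "continuous_map ?X euclideanreal (\<phi> \<circ> (\<lambda>x. x a))"
      by (intro continuous_map_compose[OF continuous_map_cube_coordinate[OF assms]]) simp
    moreover have "U = {x \<in> topspace ?X. (\<phi> \<circ> (\<lambda>x. x a)) x \<noteq> 0}"
      unfolding U \<phi>_def by auto
    ultimately show ?thesis unfolding functionally_open_def by blast
  qed
  show "\<Union>(coordinate_cover \<tau> a n) = topspace ?X"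
  proof
    show "\<Union>(coordinate_cover \<tau> a n) \<subseteq> topspace ?X" by (auto simp: coordinate_cover_def)
    show "topspace ?X \<subseteq> \<Union>(coordinate_cover \<tau> a n)"
    proof
      fix x assume x: "x \<in> topspace ?X"
      obtain q where q: "q \<in> \<rat>" "x a < q" "q < x a + 1 / real (Suc n)"
        using Rats_dense_in_real[of "x a" "x a + 1 / real (Suc n)"] by auto
      then have "\<bar>x a - q\<bar> < 1 / real (Suc n)" by simp
      then show "x \<in> \<Union>(coordinate_cover \<tau> a n)"
        using x q(1) by (auto simp: coordinate_cover_def)
    qed
  qed
qed

lemma close_for_coordinate_covers:
  assumes close: "\<And>n. cover_close Y (coordinate_cover \<tau> a n) f g" and x: "x \<in> topspace Y"
  shows "f x a = g x a"
proof -
  have "\<bar>f x a - g x a\<bar> * real (Suc n) \<le> 2" for n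
  proof -
    obtain U where U: "U \<in> coordinate_cover \<tau> a n" "f x \<in> U" "g x \<in> U"
      using close[of n] x unfolding cover_close_def by blast
    then obtain q where "\<bar>f x a - q\<bar> < 1 / real (Suc n)" "\<bar>g x a - q\<bar> < 1 / real (Suc n)"
      by (auto simp: coordinate_cover_def)
    then have "\<bar>f x a - g x a\<bar> \<le> 1 / real (Suc n) + 1 / real (Suc n)" by linarith
    then have "\<bar>f x a - g x a\<bar> * real (Suc n) \<le> (1 / real (Suc n) + 1 / real (Suc n)) * real (Suc n)"
      by (rule mult_right_mono) simp
    then show ?thesis by (simp only: distrib_right) simp
  qed
  then have "f x a - g x a = 0" by (rule zero_if_le_all_inverse)
  then show ?thesis by simp
qed

lemma infinite_Field_if_uncountable:
  assumes "Card_order \<tau>" "natLeq <o \<tau>"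
  shows "infinite (Field \<tau>)"
proof -
  have "natLeq \<le>o |Field \<tau>|"
    using ordLess_imp_ordLeq[OF assms(2)] card_of_Field_ordIso[OF assms(1)]
      ordIso_symmetric ordLeq_ordIso_trans by blast
  then show ?thesis using infinite_iff_natLeq_ordLeq[of "Field \<tau>"] by blast
qed

text \<open>
  The covers for all coordinates in \<open>A\<close> are fewer than \<open>\<tau>\<close>, as \<open>\<tau>\<close> is uncountable.  Therefore the maps
  that preserve these coordinates form an open set.  It contains the identity and hence meets the
  dense set of maps whose image is functionally separated from \<open>Z\<close>.
\<close>

lemma Z_set_avoided_over_few_coordinates:
  fixes \<tau> :: "'i rel"
  assumes \<tau>: "Card_order \<tau>" "natLeq <o \<tau>" and Z: "Z_set \<tau> (tychonoff_cube \<tau>) Z"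
    and A: "A \<subseteq> Field \<tau>" "|A| <o \<tau>"
  shows "\<exists>f. continuous_map (tychonoff_cube \<tau>) (tychonoff_cube \<tau>) f \<and>
    (\<forall>x\<in>topspace (tychonoff_cube \<tau>). f x \<notin> Z \<and> (\<forall>a\<in>A. f x a = x a))"
proof -
  define X where "X = tychonoff_cube \<tau>"
  note inf = infinite_Field_if_uncountable[OF \<tau>]
  define G where "G = {g \<in> continuous_maps X X. \<forall>x\<in>topspace X. \<forall>a\<in>A. g x a = x a}"
  define T where "T = (\<lambda>(a, n). coordinate_cover \<tau> a n) ` (A \<times> UNIV)"
  have T: "T \<subseteq> cov X" "|T| <o \<tau>"
  proof -
    show "T \<subseteq> cov X"
      using coordinate_cover_in_cov[OF subsetD[OF A(1)]] by (auto simp: T_def X_def)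
    have "|T| \<le>o |A \<times> (UNIV :: nat set)|" unfolding T_def by (rule card_of_image)
    then show "|T| <o \<tau>" using card_of_Times_nat_ordLess[OF \<tau>(2) A(2)] by (rule ordLeq_ordLess_trans)
  qed
  have ball: "map_ball X X h T \<subseteq> G" if h: "h \<in> G" for h
  proof
    fix g assume g: "g \<in> map_ball X X h T"
    have "h x a = g x a" if "a \<in> A" "x \<in> topspace X" for x a
    proof (rule close_for_coordinate_covers[of X \<tau> a h g x, OF _ that(2)])
      show "cover_close X (coordinate_cover \<tau> a n) h g" for n
        using g that(1) by (auto simp: map_ball_def T_def)
    qed
    then show "g \<in> G" using g h by (auto simp: map_ball_def G_def)
  qed
  have "open_maps \<tau> X X G"
    unfolding open_maps_def
  proof (intro conjI ballI)
    show "G \<subseteq> continuous_maps X X" by (auto simp: G_def)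
    show "\<exists>\<T>. \<T> \<subseteq> cov X \<and> |\<T>| <o \<tau> \<and> map_ball X X h \<T> \<subseteq> G" if "h \<in> G" for h
      using T ball[OF that] by blast
  qed
  then have open_G: "openin (map_space \<tau> X X) G"
    by (simp add: openin_map_space[OF \<tau>(1) inf])
  have "continuous_map X X (restrict (\<lambda>x. x) (topspace X))"
    by (rule continuous_map_eq[OF continuous_map_id]) simp
  then have id: "restrict (\<lambda>x. x) (topspace X) \<in> G"
    by (simp add: G_def continuous_maps_def)
  have "restrict (\<lambda>x. x) (topspace X) \<in> topspace (map_space \<tau> X X)"
    using id by (simp add: topspace_map_space[OF \<tau>(1) inf] G_def)
  then have "restrict (\<lambda>x. x) (topspace X) \<in> map_space \<tau> X X closure_of
      {f \<in> continuous_maps X X. functionally_separated X (f ` topspace X) Z}"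
    using Z by (simp add: Z_set_def X_def)
  then obtain f where f: "f \<in> continuous_maps X X" "functionally_separated X (f ` topspace X) Z" "f \<in> G"
    using id open_G unfolding in_closure_of by blast
  have "f x \<notin> Z" if "x \<in> topspace X" for x
    using f(2) that unfolding functionally_separated_def by force
  then show ?thesis
    using f(1,3) unfolding X_def[symmetric] by (auto simp: G_def continuous_maps_def)
qed

text \<open>
  The affine change from \<open>[0, 1]\<close> to \<open>[-1, 1]\<close> in each coordinate, together with the change from the
  value \<open>undefined\<close> to the value \<open>0\<close> outside the index set.
\<close>

definition to_cube :: "'i rel \<Rightarrow> ('i \<Rightarrow> real) \<Rightarrow> ('i \<Rightarrow> real)" where
  "to_cube \<tau> x = (\<lambda>i. if i \<in> Field \<tau> then 2 * x i - 1 else 0)"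

definition from_cube :: "'i rel \<Rightarrow> ('i \<Rightarrow> real) \<Rightarrow> ('i \<Rightarrow> real)" where
  "from_cube \<tau> y = (\<lambda>i\<in>Field \<tau>. (1 + y i) / 2)"

lemma homeomorphic_maps_to_cube:
  "homeomorphic_maps (tychonoff_cube \<tau>) (top_of_set (cube (Field \<tau>))) (to_cube \<tau>) (from_cube \<tau>)"
  unfolding homeomorphic_maps_def
proof (intro conjI ballI)
  let ?X = "tychonoff_cube \<tau>" and ?C = "cube (Field \<tau>)"
  have "continuous_map ?X euclideanreal (\<lambda>x. to_cube \<tau> x i)" for i
  proof (cases "i \<in> Field \<tau>")
    case True
    have "continuous_map ?X euclideanreal (\<lambda>x. 2 * x i - 1)"
      by (intro continuous_intros continuous_map_cube_coordinate[OF True]) simp_all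
    then show ?thesis using True by (simp add: to_cube_def)
  qed (simp add: to_cube_def)
  then have "continuous_map ?X (product_topology (\<lambda>i. euclideanreal) UNIV) (to_cube \<tau>)"
    by (simp add: continuous_map_componentwise_UNIV)
  then have "continuous_map ?X euclidean (to_cube \<tau>)"
    by (simp add: euclidean_product_topology)
  moreover have "to_cube \<tau> x \<in> ?C" if "x \<in> topspace ?X" for x
  proof (rule cubeI)
    fix i assume i: "i \<in> Field \<tau>"
    then have "0 \<le> x i" "x i \<le> 1"
      using that by (auto simp: topspace_tychonoff_cube)
    then show "\<bar>to_cube \<tau> x i\<bar> \<le> 1" using i by (simp add: to_cube_def abs_le_iff)
  qed (simp add: to_cube_def)
  ultimately show "continuous_map ?X (top_of_set ?C) (to_cube \<tau>)"
    by (auto simp: continuous_map_in_subtopology)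
  have fr: "from_cube \<tau> y i \<in> {0..1}" if "y \<in> ?C" "i \<in> Field \<tau>" for y i
    using cube_abs_le[OF that(1), of i] that(2) by (simp add: from_cube_def abs_le_iff)
  show "continuous_map (top_of_set ?C) ?X (from_cube \<tau>)"
    unfolding tychonoff_cube_def continuous_map_componentwise
  proof (intro conjI ballI)
    show "from_cube \<tau> ` topspace (top_of_set ?C) \<subseteq> extensional (Field \<tau>)"
      by (auto simp: from_cube_def)
    fix i assume i: "i \<in> Field \<tau>"
    have "continuous_on ?C (\<lambda>y. (1 + y i) / 2)"
      by (rule continuous_on_divide[OF continuous_on_add[OF continuous_on_const continuous_on_projection]
            continuous_on_const]) simp
    then have "continuous_on ?C (\<lambda>y. from_cube \<tau> y i)" using i by (simp add: from_cube_def)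
    then show "continuous_map (top_of_set ?C) (top_of_set {0..1}) (\<lambda>y. from_cube \<tau> y i)"
      using fr[OF _ i] by (auto simp: continuous_map_in_subtopology)
  qed
  show "from_cube \<tau> (to_cube \<tau> x) = x" if "x \<in> topspace ?X" for x
  proof
    fix i
    show "from_cube \<tau> (to_cube \<tau> x) i = x i"
    proof (cases "i \<in> Field \<tau>")
      case False
      then have "x i = undefined"
        using that unfolding topspace_tychonoff_cube by (intro PiE_arb)
      then show ?thesis using False by (simp add: from_cube_def)
    qed (simp add: from_cube_def to_cube_def)
  qed
  show "to_cube \<tau> (from_cube \<tau> y) = y" if "y \<in> topspace (top_of_set ?C)" for y
  proof
    fix i
    show "to_cube \<tau> (from_cube \<tau> y) i = y i"
    proof (cases "i \<in> Field \<tau>")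
      case False
      then show ?thesis using that cube_off[of y "Field \<tau>" i] by (simp add: to_cube_def)
    qed (simp add: from_cube_def to_cube_def field_simps)
  qed
qed

lemma compact_space_tychonoff_cube: "compact_space (tychonoff_cube \<tau>)"
  unfolding tychonoff_cube_def
  by (simp add: compact_space_product_topology compact_space_subtopology)

lemma Z_set_avoidable:
  fixes \<tau> :: "'i rel"
  assumes \<tau>: "Card_order \<tau>" "natLeq <o \<tau>" and Z: "Z_set \<tau> (tychonoff_cube \<tau>) Z"
  shows "avoidable \<tau> (to_cube \<tau> ` Z)"
proof -
  define X where "X = tychonoff_cube \<tau>"
  define C where "C = cube (Field \<tau>)"
  have hm: "homeomorphic_maps X (top_of_set C) (to_cube \<tau>) (from_cube \<tau>)"
    unfolding X_def C_def by (rule homeomorphic_maps_to_cube)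
  have up: "continuous_map X (top_of_set C) (to_cube \<tau>)"
    and down: "continuous_map (top_of_set C) X (from_cube \<tau>)"
    and du: "\<And>x. x \<in> topspace X \<Longrightarrow> from_cube \<tau> (to_cube \<tau> x) = x"
    and ud: "\<And>y. y \<in> C \<Longrightarrow> to_cube \<tau> (from_cube \<tau> y) = y"
    using hm by (auto simp: homeomorphic_maps_def)
  have Zc: "closedin X Z" using Z by (simp add: Z_set_def X_def)
  then have ZX: "Z \<subseteq> topspace X" by (rule closedin_subset)
  have "compactin X Z"
    using closedin_compact_space[OF compact_space_tychonoff_cube] Zc unfolding X_def by blast
  then have "compactin (top_of_set C) (to_cube \<tau> ` Z)" using up by (rule image_compactin)
  then have 1: "compact (to_cube \<tau> ` Z)" "to_cube \<tau> ` Z \<subseteq> C"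
    by (simp_all add: compactin_subtopology)
  have 2: "\<exists>f. continuous_on C f \<and> (\<forall>x\<in>C. f x \<in> C \<and> f x \<notin> to_cube \<tau> ` Z \<and> (\<forall>i\<in>A. f x i = x i))"
    if A: "A \<subseteq> Field \<tau>" "|A| <o \<tau>" for A
  proof -
    obtain f where f: "continuous_map X X f"
      "\<And>x. x \<in> topspace X \<Longrightarrow> f x \<notin> Z \<and> (\<forall>a\<in>A. f x a = x a)"
      using Z_set_avoided_over_few_coordinates[OF \<tau> Z A] unfolding X_def by blast
    define g where "g = to_cube \<tau> \<circ> (f \<circ> from_cube \<tau>)"
    have "continuous_map (top_of_set C) (top_of_set C) g"
      unfolding g_def by (intro continuous_map_compose[OF _ up] continuous_map_compose[OF down f(1)])
    then have g: "continuous_on C g" "\<And>x. x \<in> C \<Longrightarrow> g x \<in> C"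
      by (auto simp: continuous_map_in_subtopology)
    have "g x \<notin> to_cube \<tau> ` Z \<and> (\<forall>i\<in>A. g x i = x i)" if x: "x \<in> C" for x
    proof -
      define y where "y = from_cube \<tau> x"
      have y: "y \<in> topspace X" "f y \<in> topspace X"
        using continuous_map_image_subset_topspace[OF down] continuous_map_image_subset_topspace[OF f(1)] x
        by (auto simp: y_def)
      have "g x \<notin> to_cube \<tau> ` Z"
      proof
        assume "g x \<in> to_cube \<tau> ` Z"
        then obtain z where z: "z \<in> Z" "to_cube \<tau> (f y) = to_cube \<tau> z" by (auto simp: g_def y_def)
        then have "f y = z" using du[OF y(2)] du[of z] ZX by auto
        then show False using f(2)[OF y(1)] z(1) by blast
      qed
      moreover have "g x i = x i" if "i \<in> A" for i
      proof -
        have "i \<in> Field \<tau>" using that A by blast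
        then have "g x i = to_cube \<tau> y i"
          using f(2)[OF y(1)] that by (simp add: g_def y_def[symmetric] to_cube_def)
        then show ?thesis using ud[OF x] by (simp add: y_def)
      qed
      ultimately show ?thesis by blast
    qed
    then show ?thesis using g by blast
  qed
  show ?thesis
    unfolding avoidable_def C_def[symmetric] using 1 2 by blast
qed

theorem corollary4p10:
  fixes \<tau> :: "'i rel" and Z F :: "('i \<Rightarrow> real) set" and h :: "('i \<Rightarrow> real) \<Rightarrow> ('i \<Rightarrow> real)"
  assumes "Card_order \<tau>" and "natLeq <o \<tau>"
    and "Z_set \<tau> (tychonoff_cube \<tau>) Z" and "Z_set \<tau> (tychonoff_cube \<tau>) F"
    and "homeomorphic_map (subtopology (tychonoff_cube \<tau>) Z) (subtopology (tychonoff_cube \<tau>) F) h"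
  shows "\<exists>H. homeomorphic_map (tychonoff_cube \<tau>) (tychonoff_cube \<tau>) H \<and> (\<forall>z\<in>Z. H z = h z)"
proof -
  define X where "X = tychonoff_cube \<tau>"
  define C where "C = cube (Field \<tau>)"
  define u where "u = to_cube \<tau>"
  define d where "d = from_cube \<tau>"
  have hm: "homeomorphic_maps X (top_of_set C) u d"
    unfolding X_def C_def u_def d_def by (rule homeomorphic_maps_to_cube)
  have up: "continuous_map X (top_of_set C) u" and down: "continuous_map (top_of_set C) X d"
    and du: "\<And>x. x \<in> topspace X \<Longrightarrow> d (u x) = x"
    using hm by (auto simp: homeomorphic_maps_def)
  have ZX: "Z \<subseteq> topspace X" and FX: "F \<subseteq> topspace X"
    using assms(3,4) by (auto simp: Z_set_def X_def dest: closedin_subset)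
  have h: "homeomorphic_map (subtopology X Z) (subtopology X F) h"
    using assms(5) by (simp add: X_def)
  have h_cont: "continuous_map (subtopology X Z) X h"
    by (rule continuous_map_into_fulltopology[OF homeomorphic_imp_continuous_map[OF h]])
  have h_img: "h ` Z = F" "inj_on h Z"
    using homeomorphic_imp_surjective_map[OF h] homeomorphic_imp_injective_map[OF h] ZX FX
    by (simp_all add: Int_absorb1)
  have uZ: "u ` Z \<subseteq> C"
    using continuous_map_image_subset_topspace[OF up] ZX by auto
  have duZ: "d (u z) = z" if "z \<in> Z" for z using du that ZX by blast
  have duF: "d (u z) = z" if "z \<in> F" for z using du that FX by blast
  define k where "k = u \<circ> (h \<circ> d)"
  have "continuous_map (top_of_set (u ` Z)) X d"
    using continuous_map_from_subtopology[OF down, of "u ` Z"] uZ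
    by (simp add: subtopology_subtopology Int_absorb1)
  then have "continuous_map (top_of_set (u ` Z)) (subtopology X Z) d"
    using duZ by (auto simp: continuous_map_in_subtopology)
  then have "continuous_map (top_of_set (u ` Z)) (top_of_set C) k"
    unfolding k_def by (intro continuous_map_compose[OF _ up] continuous_map_compose[OF _ h_cont])
  then have k_cont: "continuous_on (u ` Z) k"
    by (auto simp: continuous_map_in_subtopology)
  have k_eq: "k (u z) = u (h z)" if "z \<in> Z" for z by (simp add: k_def duZ[OF that])
  have k_bij: "bij_betw k (u ` Z) (u ` F)"
  proof (rule bij_betw_imageI)
    show "inj_on k (u ` Z)"
    proof (rule inj_onI, clarify)
      fix z w assume zw: "z \<in> Z" "w \<in> Z" "k (u z) = k (u w)"
      then have "d (u (h z)) = d (u (h w))" by (simp add: k_eq)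
      then have "h z = h w" using duF h_img(1) zw by auto
      then show "u z = u w" using inj_onD[OF h_img(2)] zw by blast
    qed
    show "k ` u ` Z = u ` F"
      unfolding h_img(1)[symmetric] image_image by (rule image_cong[OF refl k_eq])
  qed
  obtain H where H: "autohomeo (Field \<tau>) H" "\<And>y. y \<in> u ` Z \<Longrightarrow> H y = k y"
    using avoidable_homeo_extends[OF assms(1) infinite_Field_if_uncountable[OF assms(1,2)]
        Z_set_avoidable[OF assms(1-3)] Z_set_avoidable[OF assms(1,2,4)]
        k_cont[unfolded u_def] k_bij[unfolded u_def]]
    unfolding u_def by blast
  have "homeomorphic_map (top_of_set C) (top_of_set C) H"
  proof (rule continuous_imp_homeomorphic_map)
    show "continuous_map (top_of_set C) (top_of_set C) H"
      using H(1) autohomeo_mem[OF H(1)]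
      by (auto simp: continuous_map_in_subtopology autohomeo_def C_def)
    show "H ` topspace (top_of_set C) = topspace (top_of_set C)" "inj_on H (topspace (top_of_set C))"
      using H(1) by (simp_all add: autohomeo_def bij_betw_def C_def)
  qed (simp_all add: C_def compact_space_subtopology compact_cube Hausdorff_function_subspace)
  then have "homeomorphic_map X X (d \<circ> (H \<circ> u))"
    using hm by (intro homeomorphic_map_compose[of X "top_of_set C"])
      (auto simp: homeomorphic_maps_map)
  moreover have "(d \<circ> (H \<circ> u)) z = h z" if "z \<in> Z" for z
  proof -
    have "h z \<in> F" using h_img(1) that by blast
    then show ?thesis using H(2)[OF imageI[OF that]] k_eq[OF that] duF by simp
  qed
  ultimately show ?thesis unfolding X_def by blast
qed

end
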